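(* The following six problems are pairwise strongly Weihrauch equivalent: (1) $\mathsf{UC}_{\mathbb{N}^\mathbb{N}}$; (2) $\Sigma^1_1\text{-}\mathsf{UC}_{\mathbb{N}^\mathbb{N}}$; (3) $\Sigma^1_1\text{-}\mathsf{Sep}$; (4) $\Delta^1_1\text{-}\mathsf{CA}$; (5) $\Delta^1_1\text{-}\mathsf{CA}^-$; (6) $\Sigma^1_1\text{-}\mathsf{CA}^-$.
   Context: A represented space is a set $X$ with a partial surjection $\delta_X:\subseteq\mathbb{N}^\mathbb{N}\to X$; if $\delta_X(p)=x$, $p$ is a name of $x$. A problem is a partial multivalued function $f:\subseteq X\rightrightarrows Y$ between represented spaces; a partial $F:\subseteq\mathbb{N}^\mathbb{N}\to\mathbb{N}^\mathbb{N}$ realizes $f$ if for every $x\in\operatorname{dom}(f)$ and every name $p$ of $x$, $F(p)$ is a name of some element of $f(x)$. $f$ is strongly Weihrauch reducible to $g$ ($f\le_{\mathrm{sW}}g$) if there are computable partial $H,K:\subseteq\mathbb{N}^\mathbb{N}\to\mathbb{N}^\mathbb{N}$ such that for every realizer $G$ of $g$, $p\mapsto K(G(H(p)))$ realizes $f$; strong Weihrauch equivalence means reducibility in both directions. $\mathbf{Tr}$ is the space of trees $T\subseteq\mathbb{N}^{<\mathbb{N}}$ represented by their characteristic functions (via a computable coding of $\mathbb{N}^{<\mathbb{N}}$ by $\mathbb{N}$); $[T]$ is the set of infinite paths of $T$. $\mathcal{A}(\mathbb{N}^\mathbb{N})$ is the space of closed subsets of $\mathbb{N}^\mathbb{N}$,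 where a name of $A$ is a name of a tree $T$ with $[T]=A$. $\mathsf{UC}_{\mathbb{N}^\mathbb{N}}:\subseteq\mathcal{A}(\mathbb{N}^\mathbb{N})\to\mathbb{N}^\mathbb{N}$ maps each singleton $\{x\}$ to $x$. A name of an analytic set $S\subseteq\mathbb{N}^\mathbb{N}$ (as an element of the represented space $\Sigma^1_1(\mathbb{N}^\mathbb{N})$) is a name of a closed set $P\subseteq\mathbb{N}^\mathbb{N}\times\mathbb{N}^\mathbb{N}$ (with $\mathbb{N}^\mathbb{N}\times\mathbb{N}^\mathbb{N}$ identified with $\mathbb{N}^\mathbb{N}$ via pairing) such that $S=\{x:\exists g\,(g,x)\in P\}$. $\Sigma^1_1\text{-}\mathsf{UC}_{\mathbb{N}^\mathbb{N}}:\subseteq\Sigma^1_1(\mathbb{N}^\mathbb{N})\to\mathbb{N}^\mathbb{N}$ maps each analytic singleton $\{x\}$ to $x$. $\Sigma^1_1\text{-}\mathsf{Sep}:\subseteq(\mathbf{Tr}\times\mathbf{Tr})^\mathbb{N}\rightrightarrows 2^\mathbb{N}$ has domain the sequences $(S_n,T_n)_n$ with $[S_n]=\emptyset$ or $[T_n]=\emptyset$ for every $n$, and maps such a sequence to the set of $f\in 2^\mathbb{N}$ with $[S_n]\ne\emptyset\Rightarrow f(n)=0$ and $[T_n]\neq\emptyset\Rightarrow f(n)=1$ for all $n$. $\Delta^1_1\text{-}\mathsf{CA}$ is the restriction of $\Sigma^1_1\text{-}\mathsf{Sep}$ to sequences with $[S_n]=\emptyset\leftrightarrow[T_n]\ne\emptyset$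 for all $n$; $\Delta^1_1\text{-}\mathsf{CA}^-$ is its further restriction to sequences with $|[S_n]|+|[T_n]|=1$ for all $n$. $\Sigma^1_1\text{-}\mathsf{CA}^-:\subseteq\mathbf{Tr}^\mathbb{N}\to 2^\mathbb{N}$ has domain the sequences $(T_n)_n$ with $|[T_n]|\le 1$ for all $n$, and maps $(T_n)_n$ to the unique $f$ with $f(n)=1\leftrightarrow|[T_n]|=1$. *)

theory Defs
  imports Main "HOL-Library.Nat_Bijection" "HOL-Library.Sublist"
begin

type_synonym baire = "nat \<Rightarrow> nat"

section \<open>Computability on Baire space\<close>

text \<open>
  Partial recursive functionals with an oracle \<open>p\<close> and one numerical argument: Kleene's schemata
  (initial functions, composition, primitive recursion, minimisation) plus oracle access, where
  tuples of arguments are coded by the Cantor pairing \<^const>\<open>prod_encode\<close>.  A value \<^const>\<open>None\<close>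
  means divergence; every schema is strict.
\<close>

inductive partial_recursive :: "(baire \<Rightarrow> nat \<Rightarrow> nat option) \<Rightarrow> bool" where
  zero: "partial_recursive (\<lambda>p n. Some 0)"
| succ: "partial_recursive (\<lambda>p n. Some (Suc n))"
| left: "partial_recursive (\<lambda>p n. Some (fst (prod_decode n)))"
| right: "partial_recursive (\<lambda>p n. Some (snd (prod_decode n)))"
| query: "partial_recursive (\<lambda>p n. Some (p n))"
| pair: "partial_recursive f \<Longrightarrow> partial_recursive g \<Longrightarrow>
    partial_recursive (\<lambda>p n. Option.bind (f p n) (\<lambda>a.
      Option.bind (g p n) (\<lambda>b. Some (prod_encode (a, b)))))"
| comp: "partial_recursive f \<Longrightarrow> partial_recursive g \<Longrightarrow>
    partial_recursive (\<lambda>p n. Option.bind (g p n) (f p))"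
| prec: "partial_recursive f \<Longrightarrow> partial_recursive g \<Longrightarrow>
    partial_recursive (\<lambda>p n. rec_nat (f p (fst (prod_decode n)))
      (\<lambda>k r. Option.bind r (\<lambda>v. g p (prod_encode (fst (prod_decode n), prod_encode (k, v)))))
      (snd (prod_decode n)))"
| mu: "partial_recursive f \<Longrightarrow>
    partial_recursive (\<lambda>p n.
      if \<exists>m. f p (prod_encode (n, m)) = Some 0 \<and> (\<forall>k<m. f p (prod_encode (n, k)) \<noteq> None)
      then Some (LEAST m. f p (prod_encode (n, m)) = Some 0)
      else None)"

text \<open>
  As usual, the machine is only required to work on the domain of \<open>F\<close>; its behaviour elsewhere
  is unconstrained.
\<close>

definition computable :: "(baire \<Rightarrow> baire option) \<Rightarrow> bool" where
  "computable F \<longleftrightarrow>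
    (\<exists>\<phi>. partial_recursive \<phi> \<and> (\<forall>p q. F p = Some q \<longrightarrow> (\<forall>n. \<phi> p n = Some (q n))))"

section \<open>Represented spaces, problems, strong Weihrauch reducibility\<close>

text \<open>
  A represented space is given by its representation \<open>\<delta>\<close>; the underlying set is \<^term>\<open>ran \<delta>\<close>,
  so surjectivity is automatic.
\<close>

type_synonym 'a representation = "baire \<Rightarrow> 'a option"

record ('a, 'b) problem =
  in_rep :: "'a representation"
  out_rep :: "'b representation"
  instances :: "'a set"
  solutions :: "'a \<Rightarrow> 'b set"

definition restrict_problem :: "('a, 'b) problem \<Rightarrow> 'a set \<Rightarrow> ('a, 'b) problem" where
  "restrict_problem f D = f\<lparr>instances := instances f \<inter> D\<rparr>"

definition realizes :: "(baire \<Rightarrow> baire option) \<Rightarrow> ('a, 'b) problem \<Rightarrow> bool" where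
  "realizes F f \<longleftrightarrow>
    (\<forall>x \<in> instances f. \<forall>p. in_rep f p = Some x \<longrightarrow>
      (\<exists>q y. F p = Some q \<and> out_rep f q = Some y \<and> y \<in> solutions f x))"

definition sW_reducible :: "('a, 'b) problem \<Rightarrow> ('c, 'd) problem \<Rightarrow> bool"
    (infix "\<le>\<^sub>s\<^sub>W" 50) where
  "f \<le>\<^sub>s\<^sub>W g \<longleftrightarrow>
    (\<exists>H K. computable H \<and> computable K \<and>
      (\<forall>G. realizes G g \<longrightarrow> realizes (K \<circ>\<^sub>m (G \<circ>\<^sub>m H)) f))"

definition sW_equivalent :: "('a, 'b) problem \<Rightarrow> ('c, 'd) problem \<Rightarrow> bool"
    (infix "\<equiv>\<^sub>s\<^sub>W" 50) where
  "f \<equiv>\<^sub>s\<^sub>W g \<longleftrightarrow> f \<le>\<^sub>s\<^sub>W g \<and> g \<le>\<^sub>s\<^sub>W f"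

section \<open>The represented spaces\<close>

definition baire_rep :: "baire representation" where
  "baire_rep = Some"

text \<open>Points of Cantor space are the \<open>0\<close>-\<open>1\<close>-valued elements of Baire space.\<close>

definition cantor_rep :: "baire representation" where
  "cantor_rep p = (if range p \<subseteq> {0, 1} then Some p else None)"

definition baire_pair :: "baire \<Rightarrow> baire \<Rightarrow> baire" where
  "baire_pair p q n = (if even n then p (n div 2) else q (n div 2))"

text \<open>A name of \<^term>\<open>(x, y)\<close> is \<^term>\<open>baire_pair p q\<close> for names \<open>p\<close> of \<open>x\<close> and \<open>q\<close> of \<open>y\<close>.\<close>

definition prod_rep :: "'a representation \<Rightarrow> 'b representation \<Rightarrow> ('a \<times> 'b) representation" where
  "prod_rep \<delta> \<epsilon> p =
    Option.bind (\<delta> (\<lambda>n. p (2 * n))) (\<lambda>x.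
      Option.bind (\<epsilon> (\<lambda>n. p (2 * n + 1))) (\<lambda>y. Some (x, y)))"

definition seq_rep :: "'a representation \<Rightarrow> (nat \<Rightarrow> 'a) representation" where
  "seq_rep \<delta> p =
    (if \<forall>n. \<delta> (\<lambda>k. p (prod_encode (n, k))) \<noteq> None
     then Some (\<lambda>n. the (\<delta> (\<lambda>k. p (prod_encode (n, k)))))
     else None)"

definition is_tree :: "nat list set \<Rightarrow> bool" where
  "is_tree T \<longleftrightarrow> (\<forall>\<sigma> \<in> T. \<forall>\<tau>. prefix \<tau> \<sigma> \<longrightarrow> \<tau> \<in> T)"

definition infinite_paths :: "nat list set \<Rightarrow> baire set" where
  "infinite_paths T = {x. \<forall>n. map x [0..<n] \<in> T}"

definition tree_rep :: "nat list set representation" where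
  "tree_rep p =
    (if range p \<subseteq> {0, 1} \<and> is_tree {\<sigma>. p (list_encode \<sigma>) = 1}
     then Some {\<sigma>. p (list_encode \<sigma>) = 1}
     else None)"

definition closed_rep :: "baire set representation" where
  "closed_rep p = map_option infinite_paths (tree_rep p)"

definition analytic_rep :: "baire set representation" where
  "analytic_rep p = map_option (\<lambda>P. {x. \<exists>g. baire_pair g x \<in> P}) (closed_rep p)"

section \<open>The six problems\<close>

definition UC :: "(baire set, baire) problem" where
  "UC = \<lparr>in_rep = closed_rep, out_rep = baire_rep,
    instances = {A. \<exists>x. A = {x}}, solutions = (\<lambda>A. {x. A = {x}})\<rparr>"

definition Sigma11_UC :: "(baire set, baire) problem" where
  "Sigma11_UC = \<lparr>in_rep = analytic_rep, out_rep = baire_rep,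
    instances = {A. \<exists>x. A = {x}}, solutions = (\<lambda>A. {x. A = {x}})\<rparr>"

definition Sigma11_Sep :: "(nat \<Rightarrow> nat list set \<times> nat list set, baire) problem" where
  "Sigma11_Sep = \<lparr>in_rep = seq_rep (prod_rep tree_rep tree_rep), out_rep = cantor_rep,
    instances = {X. \<forall>n. case X n of (S, T) \<Rightarrow> is_tree S \<and> is_tree T \<and>
      (infinite_paths S = {} \<or> infinite_paths T = {})},
    solutions = (\<lambda>X. {f. range f \<subseteq> {0, 1} \<and> (\<forall>n. case X n of (S, T) \<Rightarrow>
      (infinite_paths S \<noteq> {} \<longrightarrow> f n = 0) \<and> (infinite_paths T \<noteq> {} \<longrightarrow> f n = 1))})\<rparr>"

definition Delta11_CA :: "(nat \<Rightarrow> nat list set \<times> nat list set, baire) problem" where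
  "Delta11_CA = restrict_problem Sigma11_Sep
    {X. \<forall>n. case X n of (S, T) \<Rightarrow> infinite_paths S = {} \<longleftrightarrow> infinite_paths T \<noteq> {}}"

text \<open>The finiteness conditions are needed because \<^const>\<open>card\<close> is \<open>0\<close> on infinite sets.\<close>

definition Delta11_CA_minus :: "(nat \<Rightarrow> nat list set \<times> nat list set, baire) problem" where
  "Delta11_CA_minus = restrict_problem Delta11_CA
    {X. \<forall>n. case X n of (S, T) \<Rightarrow> finite (infinite_paths S) \<and> finite (infinite_paths T) \<and>
      card (infinite_paths S) + card (infinite_paths T) = 1}"

definition Sigma11_CA_minus :: "(nat \<Rightarrow> nat list set, baire) problem" where
  "Sigma11_CA_minus = \<lparr>in_rep = seq_rep tree_rep, out_rep = cantor_rep,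
    instances = {T. \<forall>n. is_tree (T n) \<and>
      finite (infinite_paths (T n)) \<and> card (infinite_paths (T n)) \<le> 1},
    solutions = (\<lambda>T. {f. range f \<subseteq> {0, 1} \<and>
      (\<forall>n. f n = 1 \<longleftrightarrow> card (infinite_paths (T n)) = 1)})\<rparr>"

end

theory Submission
  imports Defs "HOL-Library.More_List"
begin

text \<open>
  A game on \<open>\<nat>\<close> with decidable moves and no infinite play has exactly one valuation assigning to each
  position \<open>0\<close> if it is lost for the player to move, and otherwise \<open>1\<close> plus the least winning move.
  These valuations form a closed set, so unique choice decides, uniformly, who wins.

  For \<open>\<Sigma>\<^sup>1\<^sub>1-Sep\<close>, two players alternately extend a node of \<open>S\<^sub>n\<close> and a node of \<open>T\<^sub>n\<close>, and whoever cannot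
  move loses.  No play is infinite if one of the trees is well-founded, and a player whose tree has
  a path wins.  For \<open>\<Sigma>\<^sup>1\<^sub>1-CA\<^sup>-\<close> the same game is played from two different nodes of one level of a single
  tree: the tree has a path iff on every level there is a node that wins against all the others,
  and the quantifiers in this condition become the opening moves of the game.

  In the other direction, the unique solution \<open>x\<close> is read off from its graph, deciding \<open>x(n) = m\<close>
  by means of the subtrees of the given tree obtained by prescribing or excluding the value \<open>m\<close>.
\<close>

section \<open>Computability on codes of lists\<close>

text \<open>For total functions the option bookkeeping disappears, so closure rules can be chained
  by introduction alone.\<close>

definition total_recursive :: "(baire \<Rightarrow> nat \<Rightarrow> nat) \<Rightarrow> bool" where
  "total_recursive f \<longleftrightarrow> partial_recursive (\<lambda>p n. Some (f p n))"

definition decidable :: "(baire \<Rightarrow> nat \<Rightarrow> bool) \<Rightarrow> bool" where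
  "decidable P \<longleftrightarrow> total_recursive (\<lambda>p n. of_bool (P p n))"

named_theorems recursive_intros

lemma total_recursive_id [recursive_intros]: "total_recursive (\<lambda>p n. n)"
  using partial_recursive.pair[OF partial_recursive.left partial_recursive.right]
  by (simp add: total_recursive_def)

lemma total_recursive_comp:
  assumes "total_recursive f" "total_recursive a"
  shows "total_recursive (\<lambda>p n. f p (a p n))"
  using partial_recursive.comp[OF assms[unfolded total_recursive_def]]
  by (simp add: total_recursive_def)

lemma total_recursive_Suc [recursive_intros]:
  "total_recursive a \<Longrightarrow> total_recursive (\<lambda>p n. Suc (a p n))"
  using total_recursive_comp[of "\<lambda>p. Suc"] partial_recursive.succ
  by (simp add: total_recursive_def)

lemma total_recursive_const [recursive_intros]: "total_recursive (\<lambda>p n. c)"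
proof (induction c)
  case 0
  show ?case using partial_recursive.zero by (simp add: total_recursive_def)
qed (rule total_recursive_Suc)

lemma total_recursive_query [recursive_intros]:
  "total_recursive a \<Longrightarrow> total_recursive (\<lambda>p n. p (a p n))"
  using total_recursive_comp[of "\<lambda>p. p"] partial_recursive.query
  by (simp add: total_recursive_def)

lemma total_recursive_fst [recursive_intros]:
  "total_recursive a \<Longrightarrow> total_recursive (\<lambda>p n. fst (prod_decode (a p n)))"
  using total_recursive_comp[of "\<lambda>p n. fst (prod_decode n)"] partial_recursive.left
  by (simp add: total_recursive_def)

lemma total_recursive_snd [recursive_intros]:
  "total_recursive a \<Longrightarrow> total_recursive (\<lambda>p n. snd (prod_decode (a p n)))"
  using total_recursive_comp[of "\<lambda>p n. snd (prod_decode n)"] partial_recursive.right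
  by (simp add: total_recursive_def)

lemma total_recursive_pair [recursive_intros]:
  assumes "total_recursive a" "total_recursive b"
  shows "total_recursive (\<lambda>p n. prod_encode (a p n, b p n))"
  using partial_recursive.pair[OF assms[unfolded total_recursive_def]]
  by (simp add: total_recursive_def)

text \<open>\<open>prec\<close> splits its argument into parameter and length, whereas here both
  depend on \<open>n\<close>: take \<open>n\<close> itself as the parameter and compose with the
  pair of \<open>n\<close> and \<open>b p n\<close>. The last hypothesis reads the three arguments
  of \<open>g\<close> from the nested pair that \<open>prec\<close> passes to its step
  function.\<close>

lemma total_recursive_rec_nat [recursive_intros]:
  assumes a: "total_recursive a" and b: "total_recursive b"
    and g: "total_recursive (\<lambda>p z. g p (fst (prod_decode z))
      (fst (prod_decode (snd (prod_decode z)))) (snd (prod_decode (snd (prod_decode z)))))"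
  shows "total_recursive (\<lambda>p n. rec_nat (a p n) (g p n) (b p n))"
proof -
  have rec: "rec_nat (Some (a p m)) (\<lambda>k r. Option.bind r (\<lambda>v. Some (g p m k v))) j
      = Some (rec_nat (a p m) (g p m) j)" for p m j
    by (induction j) simp_all
  have "total_recursive (\<lambda>p z. rec_nat (a p (fst (prod_decode z))) (g p (fst (prod_decode z)))
      (snd (prod_decode z)))"
    using partial_recursive.prec[OF a[unfolded total_recursive_def] g[unfolded total_recursive_def]]
    by (simp add: total_recursive_def rec)
  from total_recursive_comp[OF this total_recursive_pair[OF total_recursive_id b]]
  show ?thesis by simp
qed

section \<open>Arithmetic, case distinctions and bounded quantifiers\<close>

lemma total_recursive_diff [recursive_intros]:
  assumes "total_recursive a" "total_recursive b"
  shows "total_recursive (\<lambda>p n. a p n - b p n)"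
proof -
  \<comment> \<open>Predecessor: the recursion returns its index and forgets the previous value.
    Iterating it gives truncated subtraction.\<close>
  have pred: "rec_nat 0 (\<lambda>k v. k) m = m - 1" for m :: nat
    by (cases m) simp_all
  have diff: "rec_nat i (\<lambda>k v. rec_nat 0 (\<lambda>k v. k) v) j = i - j" for i j :: nat
    by (induction j) (simp_all add: pred)
  have "total_recursive (\<lambda>p n. rec_nat (a p n) (\<lambda>k v. rec_nat 0 (\<lambda>k v. k) v) (b p n))"
    by (intro recursive_intros assms)
  then show ?thesis by (simp add: diff)
qed

lemma total_recursive_add [recursive_intros]:
  assumes "total_recursive a" "total_recursive b"
  shows "total_recursive (\<lambda>p n. a p n + b p n)"
proof -
  have add: "rec_nat i (\<lambda>k v. Suc v) j = i + j" for i j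
    by (induction j) simp_all
  have "total_recursive (\<lambda>p n. rec_nat (a p n) (\<lambda>k v. Suc v) (b p n))"
    by (intro recursive_intros assms)
  then show ?thesis by (simp add: add)
qed

lemma total_recursive_mult [recursive_intros]:
  assumes "total_recursive a" "total_recursive b"
  shows "total_recursive (\<lambda>p n. a p n * b p n)"
proof -
  have mult: "rec_nat 0 (\<lambda>k v. v + i) j = i * j" for i j :: nat
    by (induction j) simp_all
  have "total_recursive (\<lambda>p n. rec_nat 0 (\<lambda>k v. v + a p n) (b p n))"
    by (intro recursive_intros total_recursive_comp[OF assms(1)] assms)
  then show ?thesis by (simp add: mult)
qed

lemma total_recursive_of_bool [recursive_intros]:
  "decidable P \<Longrightarrow> total_recursive (\<lambda>p n. of_bool (P p n))"
  by (simp add: decidable_def)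

text \<open>The truth value serves as the length of a recursion: no step yields the second branch,
  one step the first.\<close>

lemma total_recursive_if [recursive_intros]:
  assumes "decidable P" "total_recursive a" "total_recursive b"
  shows "total_recursive (\<lambda>p n. if P p n then a p n else b p n)"
proof -
  have if_eq: "rec_nat j (\<lambda>k v. i) (of_bool Q) = (if Q then i else j)" for i j :: nat and Q
    by simp
  have "total_recursive (\<lambda>p n. rec_nat (b p n) (\<lambda>k v. a p n) (of_bool (P p n)))"
    by (intro recursive_intros total_recursive_comp[OF assms(2)] assms)
  then show ?thesis by (simp only: if_eq)
qed

lemma decidable_le [recursive_intros]:
  assumes "total_recursive a" "total_recursive b"
  shows "decidable (\<lambda>p n. a p n \<le> b p n)"
proof -
  have le: "1 - (i - j) = of_bool (i \<le> j)" for i j :: nat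
    by simp
  have "total_recursive (\<lambda>p n. 1 - (a p n - b p n))"
    by (intro recursive_intros assms)
  then show ?thesis by (simp only: decidable_def le)
qed

lemma decidable_not [recursive_intros]:
  assumes "decidable P"
  shows "decidable (\<lambda>p n. \<not> P p n)"
proof -
  have "total_recursive (\<lambda>p n. 1 - of_bool (P p n))"
    by (intro recursive_intros assms)
  moreover have "1 - of_bool Q = (of_bool (\<not> Q) :: nat)" for Q
    by simp
  ultimately show ?thesis by (simp only: decidable_def)
qed

lemma decidable_conj [recursive_intros]:
  assumes "decidable P" "decidable Q"
  shows "decidable (\<lambda>p n. P p n \<and> Q p n)"
proof -
  have "total_recursive (\<lambda>p n. of_bool (P p n) * of_bool (Q p n))"
    by (intro recursive_intros assms)
  then show ?thesis by (simp only: decidable_def of_bool_conj)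
qed

lemma decidable_imp [recursive_intros]:
  assumes "decidable P" "decidable Q"
  shows "decidable (\<lambda>p n. P p n \<longrightarrow> Q p n)"
  using decidable_not[OF decidable_conj[OF assms(1) decidable_not[OF assms(2)]]] by simp

lemma decidable_disj [recursive_intros]:
  assumes "decidable P" "decidable Q"
  shows "decidable (\<lambda>p n. P p n \<or> Q p n)"
  unfolding disj_imp by (rule decidable_imp[OF decidable_not[OF assms(1)] assms(2)])

lemma decidable_iff [recursive_intros]:
  assumes "decidable P" "decidable Q"
  shows "decidable (\<lambda>p n. P p n \<longleftrightarrow> Q p n)"
  unfolding iff_conv_conj_imp by (intro recursive_intros assms)

lemma decidable_less [recursive_intros]:
  assumes "total_recursive a" "total_recursive b"
  shows "decidable (\<lambda>p n. a p n < b p n)"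
  using decidable_not[OF decidable_le[OF assms(2,1)]] by (simp add: not_le)

lemma decidable_eq [recursive_intros]:
  fixes a b :: "baire \<Rightarrow> nat \<Rightarrow> nat"
  assumes "total_recursive a" "total_recursive b"
  shows "decidable (\<lambda>p n. a p n = b p n)"
  using decidable_conj[OF decidable_le[OF assms] decidable_le[OF assms(2,1)]]
  by (simp only: order.eq_iff[symmetric])

lemma decidable_comp:
  "decidable P \<Longrightarrow> total_recursive a \<Longrightarrow> decidable (\<lambda>p n. P p (a p n))"
  unfolding decidable_def by (rule total_recursive_comp)

lemma decidable_all_less [recursive_intros]:
  assumes b: "total_recursive b"
    and P: "decidable (\<lambda>p z. P p (fst (prod_decode z)) (snd (prod_decode z)))"
  shows "decidable (\<lambda>p n. \<forall>k<b p n. P p n k)"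
proof -
  have all: "rec_nat 1 (\<lambda>k v. if Q k then v else 0) j = (of_bool (\<forall>k<j. Q k) :: nat)" for Q j
    by (induction j) (auto simp: less_Suc_eq)
  \<comment> \<open>Inside the recursion the argument codes \<open>n\<close>, \<open>k\<close> and
    the accumulated value; this repacks the first two for \<open>P\<close>.\<close>
  have P': "decidable (\<lambda>p z. P p (fst (prod_decode z)) (fst (prod_decode (snd (prod_decode z)))))"
    using decidable_comp[OF P, of "\<lambda>p z. prod_encode (fst (prod_decode z), fst (prod_decode (snd (prod_decode z))))"]
    by (simp add: recursive_intros)
  have "total_recursive (\<lambda>p n. rec_nat 1 (\<lambda>k v. if P p n k then v else 0) (b p n))"
    by (intro recursive_intros b P')
  then show ?thesis by (simp only: decidable_def all)
qed

lemma total_recursive_mod_2 [recursive_intros]: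
  assumes "total_recursive a"
  shows "total_recursive (\<lambda>p n. a p n mod 2)"
proof -
  have mod: "rec_nat 0 (\<lambda>k v. 1 - v) j = j mod 2" for j :: nat
    by (induction j) (simp_all add: mod_Suc)
  have "total_recursive (\<lambda>p n. rec_nat 0 (\<lambda>k v. 1 - v) (a p n))"
    by (intro recursive_intros assms)
  then show ?thesis by (simp only: mod)
qed

lemma total_recursive_div_2 [recursive_intros]:
  assumes "total_recursive a"
  shows "total_recursive (\<lambda>p n. a p n div 2)"
proof -
  have div: "rec_nat 0 (\<lambda>k v. v + k mod 2) j = j div 2" for j :: nat
    by (induction j) (simp, simp, presburger)
  have "total_recursive (\<lambda>p n. rec_nat 0 (\<lambda>k v. v + k mod 2) (a p n))"
    by (intro recursive_intros assms)
  then show ?thesis by (simp only: div)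
qed

section \<open>Operations on coded finite sequences\<close>

lemma prod_decode_0: "prod_decode 0 = (0, 0)"
  by (simp add: prod_decode_def prod_decode_aux.simps)

text \<open>A nonempty list has the code \<open>Suc (prod_encode (x, list_encode xs))\<close>, so
  one step strips the head. The code 0 of the empty list is a fixed point, because
  \<open>0 - 1 = 0\<close> and \<open>prod_decode 0 = (0, 0)\<close>.\<close>

lemma rec_nat_drop:
  "rec_nat (list_encode xs) (\<lambda>k v. snd (prod_decode (v - 1))) i = list_encode (drop i xs)"
proof (induction i)
  case (Suc i)
  have "snd (prod_decode (list_encode ys - 1)) = list_encode (tl ys)" for ys
    by (cases ys) (simp_all add: prod_decode_0)
  then show ?case using Suc by (simp add: drop_Suc tl_drop)
qed simp

lemma total_recursive_drop:
  assumes "total_recursive a" "total_recursive b"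
  shows "total_recursive (\<lambda>p n. list_encode (drop (b p n) (list_decode (a p n))))"
proof -
  have "total_recursive (\<lambda>p n. rec_nat (a p n) (\<lambda>k v. snd (prod_decode (v - 1))) (b p n))"
    by (intro recursive_intros assms)
  then show ?thesis using rec_nat_drop[of "list_decode _"] by simp
qed

lemma total_recursive_nth [recursive_intros]:
  assumes "total_recursive a" "total_recursive b"
  shows "total_recursive (\<lambda>p n. nth_default 0 (list_decode (a p n)) (b p n))"
proof -
  have hd: "fst (prod_decode (list_encode (drop i xs) - 1)) = nth_default 0 xs i" for xs i
  proof (cases "i < length xs")
    case True
    then show ?thesis by (simp add: Cons_nth_drop_Suc[symmetric] nth_default_nth)
  next
    case False
    then show ?thesis
      by (simp add: nth_default_beyond prod_decode_0)
  qed
  have "total_recursive (\<lambda>p n. fst (prod_decode (list_encode (drop (b p n) (list_decode (a p n))) - 1)))"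
    by (intro recursive_intros total_recursive_drop assms)
  then show ?thesis by (simp only: hd)
qed

lemma length_le_list_encode: "length xs \<le> list_encode xs"
proof (induction xs)
  case (Cons x xs)
  then show ?case using le_prod_encode_2[of "list_encode xs" x] by simp
qed simp

text \<open>The length counts the indices \<open>k\<close> at which \<open>drop k xs\<close> is
  nonempty; by \<open>length_le_list_encode\<close> all of them lie below the code of the
  list.\<close>

lemma total_recursive_length [recursive_intros]:
  assumes "total_recursive a"
  shows "total_recursive (\<lambda>p n. length (list_decode (a p n)))"
proof -
  have count: "rec_nat 0 (\<lambda>k v. if list_encode (drop k xs) = 0 then v else Suc v) j = min j (length xs)"
    for xs j
  proof (induction j)
    case (Suc j)
    have "list_encode (drop j xs) = 0 \<longleftrightarrow> length xs \<le> j"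
      by (metis drop_eq_Nil list_encode.simps(1) list_encode_eq)
    then show ?case using Suc by auto
  qed simp
  have "total_recursive (\<lambda>p n. rec_nat 0
      (\<lambda>k v. if list_encode (drop k (list_decode (a p n))) = 0 then v else Suc v) (a p n))"
    by (intro recursive_intros total_recursive_drop total_recursive_comp[OF assms] assms)
  moreover have "min m (length (list_decode m)) = length (list_decode m)" for m
    using length_le_list_encode[of "list_decode m"] by simp
  ultimately show ?thesis by (simp only: count)
qed

text \<open>Codes grow at the head, so the list is built from its last entry backwards: stage
  \<open>k\<close> prepends the value at \<open>l p n - Suc k\<close>.\<close>

lemma total_recursive_map_upt [recursive_intros]:
  assumes l: "total_recursive l"
    and g: "total_recursive (\<lambda>p z. g p (fst (prod_decode z)) (snd (prod_decode z)))"
  shows "total_recursive (\<lambda>p n. list_encode (map (g p n) [0..<l p n]))"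
proof -
  have rec: "rec_nat 0 (\<lambda>k v. Suc (prod_encode (h (m - Suc k), v))) j
      = list_encode (map h [m - j..<m])" if "j \<le> m" for h m j
    using that
  proof (induction j)
    case (Suc j)
    then have "[m - Suc j..<m] = (m - Suc j) # [m - j..<m]"
      by (simp add: upt_conv_Cons Suc_diff_Suc)
    then show ?case using Suc by simp
  qed simp
  have g': "total_recursive (\<lambda>p z. g p (fst (prod_decode z))
      (l p (fst (prod_decode z)) - Suc (fst (prod_decode (snd (prod_decode z))))))"
    using total_recursive_comp[OF g, of "\<lambda>p z. prod_encode (fst (prod_decode z),
      l p (fst (prod_decode z)) - Suc (fst (prod_decode (snd (prod_decode z)))))"]
    by (simp add: recursive_intros total_recursive_comp[OF l])
  have "total_recursive (\<lambda>p n. rec_nat 0 (\<lambda>k v. Suc (prod_encode (g p n (l p n - Suc k), v))) (l p n))"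
    by (intro recursive_intros g' l)
  then show ?thesis by (simp only: rec[OF order_refl] diff_self_eq_0)
qed

text \<open>Turns the prefix relation into a comparison of lengths and a bounded quantifier over
  total lookups, which the closure rules cover. The indices lie within both lists, so the default is
  never read.\<close>

lemma prefix_iff_nth_default:
  "prefix xs ys \<longleftrightarrow> length xs \<le> length ys \<and> (\<forall>i<length xs. nth_default 0 xs i = nth_default 0 ys i)"
proof
  assume R: "length xs \<le> length ys \<and> (\<forall>i<length xs. nth_default 0 xs i = nth_default 0 ys i)"
  then have "take (length xs) ys = xs"
    by (intro nth_equalityI) (auto simp: nth_default_nth)
  then show "prefix xs ys" using take_is_prefix[of "length xs" ys] by simp
qed (auto simp: prefix_def nth_default_append nth_default_nth)

lemma decidable_prefix [recursive_intros]:
  assumes "total_recursive a" "total_recursive b"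
  shows "decidable (\<lambda>p n. prefix (list_decode (a p n)) (list_decode (b p n)))"
  unfolding prefix_iff_nth_default
  by (intro recursive_intros total_recursive_comp[OF assms(1)] total_recursive_comp[OF assms(2)] assms)

section \<open>Strong Weihrauch reductions\<close>

lemma computable_total:
  assumes "total_recursive h"
  shows "computable (\<lambda>p. Some (h p))"
  using assms unfolding computable_def total_recursive_def by auto

lemma computable_Some: "computable Some"
  using computable_total[OF total_recursive_query[OF total_recursive_id]] .

text \<open>Oracle substitution: every query is replaced by a call of \<open>\<psi>\<close>, and the
  other schemata touch the oracle only through their constituents. The claim concerns those
  \<open>p\<close> at which \<open>\<psi>\<close> is total, where it defines an oracle
  \<open>q\<close> to simulate.\<close>

lemma partial_recursive_oracle:
  assumes "partial_recursive \<phi>" and \<psi>: "partial_recursive \<psi>"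
  shows "\<exists>\<chi>. partial_recursive \<chi> \<and> (\<forall>p q. \<psi> p = (\<lambda>n. Some (q n)) \<longrightarrow> \<chi> p = \<phi> q)"
  using assms(1)
proof induction
  case query
  show ?case using \<psi> by (intro exI[of _ \<psi>]) simp
next
  case (pair f g)
  then obtain f' g' where IH:
    "partial_recursive f'" "\<And>p q. \<psi> p = (\<lambda>n. Some (q n)) \<Longrightarrow> f' p = f q"
    "partial_recursive g'" "\<And>p q. \<psi> p = (\<lambda>n. Some (q n)) \<Longrightarrow> g' p = g q" by blast
  show ?case
  proof (intro exI conjI allI impI)
    fix p q assume "\<psi> p = (\<lambda>n. Some (q n))"
    note eq = IH(2)[OF this] IH(4)[OF this]
    show "(\<lambda>p n. Option.bind (f' p n) (\<lambda>a. Option.bind (g' p n) (\<lambda>b. Some (prod_encode (a, b))))) p = (\<lambda>p n. Option.bind (f p n) (\<lambda>a. Option.bind (g p n) (\<lambda>b. Some (prod_encode (a, b))))) q" by (simp only: eq)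
  qed (rule partial_recursive.pair[OF IH(1) IH(3)])
next
  case (comp f g)
  then obtain f' g' where IH:
    "partial_recursive f'" "\<And>p q. \<psi> p = (\<lambda>n. Some (q n)) \<Longrightarrow> f' p = f q"
    "partial_recursive g'" "\<And>p q. \<psi> p = (\<lambda>n. Some (q n)) \<Longrightarrow> g' p = g q" by blast
  show ?case
  proof (intro exI conjI allI impI)
    fix p q assume "\<psi> p = (\<lambda>n. Some (q n))"
    note eq = IH(2)[OF this] IH(4)[OF this]
    show "(\<lambda>p n. Option.bind (g' p n) (f' p)) p = (\<lambda>p n. Option.bind (g p n) (f p)) q" by (simp only: eq)
  qed (rule partial_recursive.comp[OF IH(1) IH(3)])
next
  case (prec f g)
  then obtain f' g' where IH:
    "partial_recursive f'" "\<And>p q. \<psi> p = (\<lambda>n. Some (q n)) \<Longrightarrow> f' p = f q"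
    "partial_recursive g'" "\<And>p q. \<psi> p = (\<lambda>n. Some (q n)) \<Longrightarrow> g' p = g q" by blast
  show ?case
  proof (intro exI conjI allI impI)
    fix p q assume "\<psi> p = (\<lambda>n. Some (q n))"
    note eq = IH(2)[OF this] IH(4)[OF this]
    show "(\<lambda>p n. rec_nat (f' p (fst (prod_decode n)))
      (\<lambda>k r. Option.bind r (\<lambda>v. g' p (prod_encode (fst (prod_decode n), prod_encode (k, v)))))
      (snd (prod_decode n))) p = (\<lambda>p n. rec_nat (f p (fst (prod_decode n)))
      (\<lambda>k r. Option.bind r (\<lambda>v. g p (prod_encode (fst (prod_decode n), prod_encode (k, v)))))
      (snd (prod_decode n))) q" by (simp only: eq)
  qed (rule partial_recursive.prec[OF IH(1) IH(3)])
next
  case (mu f)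
  then obtain f' where IH:
    "partial_recursive f'" "\<And>p q. \<psi> p = (\<lambda>n. Some (q n)) \<Longrightarrow> f' p = f q" by blast
  show ?case
  proof (intro exI conjI allI impI)
    fix p q assume "\<psi> p = (\<lambda>n. Some (q n))"
    note eq = IH(2)[OF this]
    show "(\<lambda>p n. if \<exists>m. f' p (prod_encode (n, m)) = Some 0 \<and> (\<forall>k<m. f' p (prod_encode (n, k)) \<noteq> None)
      then Some (LEAST m. f' p (prod_encode (n, m)) = Some 0) else None) p = (\<lambda>p n. if \<exists>m. f p (prod_encode (n, m)) = Some 0 \<and> (\<forall>k<m. f p (prod_encode (n, k)) \<noteq> None)
      then Some (LEAST m. f p (prod_encode (n, m)) = Some 0) else None) q" by (simp only: eq)
  qed (rule partial_recursive.mu[OF IH(1)])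
qed (blast intro: partial_recursive.intros)+

lemma computable_map_comp:
  assumes "computable F" "computable G"
  shows "computable (G \<circ>\<^sub>m F)"
proof -
  obtain \<phi> where \<phi>: "partial_recursive \<phi>" "\<And>p q. F p = Some q \<Longrightarrow> \<phi> p = (\<lambda>n. Some (q n))"
    using assms(1) unfolding computable_def fun_eq_iff by blast
  obtain \<gamma> where \<gamma>: "partial_recursive \<gamma>" "\<And>p q n. G p = Some q \<Longrightarrow> \<gamma> p n = Some (q n)"
    using assms(2) unfolding computable_def by blast
  obtain \<chi> where \<chi>: "partial_recursive \<chi>" "\<And>p q. \<phi> p = (\<lambda>n. Some (q n)) \<Longrightarrow> \<chi> p = \<gamma> q"
    using partial_recursive_oracle[OF \<gamma>(1) \<phi>(1)] by blast
  have "\<chi> p n = Some (q n)" if pq: "(G \<circ>\<^sub>m F) p = Some q" for p q n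
  proof -
    obtain r where r: "F p = Some r" "G r = Some q"
      using pq by (auto simp: map_comp_Some_iff)
    show ?thesis using \<chi>(2)[OF \<phi>(2)[OF r(1)]] \<gamma>(2)[OF r(2)] by simp
  qed
  with \<chi>(1) show ?thesis unfolding computable_def by blast
qed

lemma map_comp_assoc: "(f \<circ>\<^sub>m g) \<circ>\<^sub>m h = f \<circ>\<^sub>m (g \<circ>\<^sub>m h)"
  by (auto simp: map_comp_def fun_eq_iff split: option.split)

lemma sW_reducible_trans [trans]:
  assumes "f \<le>\<^sub>s\<^sub>W g" "g \<le>\<^sub>s\<^sub>W h"
  shows "f \<le>\<^sub>s\<^sub>W h"
proof -
  obtain H K where 1: "computable H" "computable K"
    "\<And>G. realizes G g \<Longrightarrow> realizes (K \<circ>\<^sub>m (G \<circ>\<^sub>m H)) f"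
    using assms(1) unfolding sW_reducible_def by blast
  obtain H' K' where 2: "computable H'" "computable K'"
    "\<And>G. realizes G h \<Longrightarrow> realizes (K' \<circ>\<^sub>m (G \<circ>\<^sub>m H')) g"
    using assms(2) unfolding sW_reducible_def by blast
  have "realizes ((K \<circ>\<^sub>m K') \<circ>\<^sub>m (G \<circ>\<^sub>m (H' \<circ>\<^sub>m H))) f" if "realizes G h" for G
    using 1(3)[OF 2(3)[OF that]] by (simp add: map_comp_assoc)
  with 1 2 show ?thesis
    unfolding sW_reducible_def by (blast intro: computable_map_comp)
qed

text \<open>Eliminates the quantifier over realizers: a realizer matters only through its value at
  the transformed name, which is a name of some solution. \<open>K\<close> receives that name alone,
  as strong reducibility demands.\<close>

lemma sW_reducibleI:
  assumes "computable H" "computable K"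
    and "\<And>x p. x \<in> instances f \<Longrightarrow> in_rep f p = Some x \<Longrightarrow>
      \<exists>p' x'. H p = Some p' \<and> in_rep g p' = Some x' \<and> x' \<in> instances g \<and>
        (\<forall>q y. out_rep g q = Some y \<longrightarrow> y \<in> solutions g x' \<longrightarrow>
          (\<exists>q' y'. K q = Some q' \<and> out_rep f q' = Some y' \<and> y' \<in> solutions f x))"
  shows "f \<le>\<^sub>s\<^sub>W g"
proof -
  have "realizes (K \<circ>\<^sub>m (G \<circ>\<^sub>m H)) f" if G: "realizes G g" for G
    unfolding realizes_def
  proof (intro ballI allI impI)
    fix x p assume "x \<in> instances f" "in_rep f p = Some x"
    from assms(3)[OF this] obtain p' x' where "H p = Some p'" "in_rep g p' = Some x'"
      "x' \<in> instances g" and K: "\<And>q y. out_rep g q = Some y \<Longrightarrow> y \<in> solutions g x' \<Longrightarrow>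
          (\<exists>q' y'. K q = Some q' \<and> out_rep f q' = Some y' \<and> y' \<in> solutions f x)" by blast
    moreover from this G obtain q y where "G p' = Some q" "out_rep g q = Some y" "y \<in> solutions g x'"
      unfolding realizes_def by blast
    ultimately show "\<exists>q y. (K \<circ>\<^sub>m (G \<circ>\<^sub>m H)) p = Some q \<and> out_rep f q = Some y \<and> y \<in> solutions f x"
      using K[of q y] by (auto simp: map_comp_Some_iff)
  qed
  with assms(1,2) show ?thesis unfolding sW_reducible_def by blast
qed

lemma restrict_problem_sW_reducible: "restrict_problem f D \<le>\<^sub>s\<^sub>W f"
  by (rule sW_reducibleI[OF computable_Some computable_Some]) (auto simp: restrict_problem_def)

text \<open>Recovers a function from the characteristic function of its graph. Rows without a 1 are
  kept out of the domain, so a single unbounded search computes it.\<close>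

definition decode_graph :: "baire \<Rightarrow> baire option" where
  "decode_graph q = (if \<forall>n. \<exists>m. q (prod_encode (n, m)) = 1
     then Some (\<lambda>n. LEAST m. q (prod_encode (n, m)) = 1) else None)"

lemma computable_decode_graph: "computable decode_graph"
proof -
  define \<psi> where "\<psi> = (\<lambda>(p :: baire) z. Some (if p z = 1 then 0 else 1 :: nat))"
  have "total_recursive (\<lambda>p z. if p z = 1 then 0 else 1)"
    by (intro recursive_intros)
  then have "partial_recursive \<psi>"
    by (simp add: total_recursive_def \<psi>_def)
  note partial_recursive.mu[OF this]
  moreover have "\<psi> p z \<noteq> None" "\<psi> p z = Some 0 \<longleftrightarrow> p z = 1" for p z
    by (simp_all add: \<psi>_def)
  ultimately have "partial_recursive (\<lambda>p n. if \<exists>m. p (prod_encode (n, m)) = 1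
      then Some (LEAST m. p (prod_encode (n, m)) = 1) else None)" (is "partial_recursive ?\<phi>")
    by (simp cong: if_cong)
  then show ?thesis
    unfolding computable_def decode_graph_def by (intro exI[of _ ?\<phi>]) (auto split: if_splits)
qed

lemma decode_graph_eq:
  assumes "\<And>n m. q (prod_encode (n, m)) = 1 \<longleftrightarrow> x n = m"
  shows "decode_graph q = Some x"
proof -
  have "(LEAST m. q (prod_encode (n, m)) = 1) = x n" for n
    unfolding assms by (rule Least_equality) simp_all
  then show ?thesis unfolding decode_graph_def assms by simp
qed

section \<open>Names of trees\<close>

lemma tree_rep_of_bool:
  "is_tree T \<Longrightarrow> tree_rep (\<lambda>k. of_bool (list_decode k \<in> T)) = Some T"
  by (auto simp: tree_rep_def)

lemma tree_rep_eq_Some: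
  assumes "tree_rep p = Some T"
  shows "is_tree T" "\<sigma> \<in> T \<longleftrightarrow> p (list_encode \<sigma>) = 1"
  using assms by (auto simp: tree_rep_def split: if_splits)

lemma seq_rep_eq_Some:
  "seq_rep \<delta> p = Some x \<longleftrightarrow> (\<forall>n. \<delta> (\<lambda>k. p (prod_encode (n, k))) = Some (x n))"
  by (simp add: seq_rep_def fun_eq_iff) (metis not_None_eq option.sel)

lemma prod_rep_eq_Some:
  "prod_rep \<delta> \<epsilon> p = Some z \<longleftrightarrow>
    \<delta> (\<lambda>n. p (2 * n)) = Some (fst z) \<and> \<epsilon> (\<lambda>n. p (2 * n + 1)) = Some (snd z)"
  by (cases z) (auto simp: prod_rep_def bind_eq_Some_conv)

lemma cantor_rep_eq_Some: "cantor_rep p = Some f \<longleftrightarrow> f = p \<and> range p \<subseteq> {0, 1}"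
  by (auto simp: cantor_rep_def)

text \<open>Nodes too short to have an entry \<open>i\<close> are kept, so that the result is closed
  under prefixes.\<close>

definition coordinate_tree :: "nat list set \<Rightarrow> nat \<Rightarrow> nat set \<Rightarrow> nat list set" where
  "coordinate_tree T i M = {\<sigma> \<in> T. i < length \<sigma> \<longrightarrow> \<sigma> ! i \<in> M}"

lemma is_tree_coordinate_tree:
  assumes "is_tree T"
  shows "is_tree (coordinate_tree T i M)"
  using assms unfolding is_tree_def coordinate_tree_def
  by (auto simp: prefix_def nth_append)

lemma infinite_paths_coordinate_tree:
  "infinite_paths (coordinate_tree T i M) = {x \<in> infinite_paths T. x i \<in> M}"
  unfolding infinite_paths_def coordinate_tree_def
  by (auto dest: spec[of _ "Suc i"])

text \<open>The index \<open>z\<close> codes the question whether the sought \<open>x\<close> has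
  value \<open>m\<close> at \<open>n\<close>; the first tree has a path if the answer is no, the
  second if it is yes. The map \<open>e\<close> says at which coordinate of a path the value
  \<open>x n\<close> is stored.\<close>

definition graph_trees :: "nat list set \<Rightarrow> (nat \<Rightarrow> nat) \<Rightarrow> nat \<Rightarrow> nat list set \<times> nat list set" where
  "graph_trees T e z = (case prod_decode z of (n, m) \<Rightarrow>
    (coordinate_tree T (e n) (- {m}), coordinate_tree T (e n) {m}))"

text \<open>The argument codes \<open>n\<close>, \<open>m\<close> and an index \<open>j\<close> into
  a name of a pair of trees: the parity of \<open>j\<close> selects the tree, \<open>j div 2\<close>
  is the code of the node.\<close>

definition graph_trees_name :: "(nat \<Rightarrow> nat) \<Rightarrow> baire \<Rightarrow> baire" where
  "graph_trees_name e p z =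
    (let n = fst (prod_decode (fst (prod_decode z))); m = snd (prod_decode (fst (prod_decode z)));
         j = snd (prod_decode z); k = j div 2
     in of_bool (p k = 1 \<and> (e n < length (list_decode k) \<longrightarrow>
          (nth_default 0 (list_decode k) (e n) = m \<longleftrightarrow> j mod 2 = 1))))"

lemma total_recursive_graph_trees_name:
  assumes "total_recursive (\<lambda>p. e)"
  shows "total_recursive (graph_trees_name e)"
  unfolding graph_trees_name_def[abs_def] Let_def
  by (intro recursive_intros total_recursive_comp[OF assms])

lemma graph_trees_name:
  assumes "tree_rep p = Some T"
  shows "seq_rep (prod_rep tree_rep tree_rep) (graph_trees_name e p) = Some (graph_trees T e)"
proof -
  note T = tree_rep_eq_Some[OF assms]
  have "tree_rep (\<lambda>k. graph_trees_name e p (prod_encode (prod_encode (n, m), 2 * k)))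
      = Some (coordinate_tree T (e n) (- {m}))" for n m
    using tree_rep_of_bool[OF is_tree_coordinate_tree[OF T(1), of "e n" "- {m}"]]
    by (simp add: graph_trees_name_def coordinate_tree_def T(2) nth_default_def cong: conj_cong imp_cong)
  moreover have "tree_rep (\<lambda>k. graph_trees_name e p (prod_encode (prod_encode (n, m), Suc (2 * k))))
      = Some (coordinate_tree T (e n) {m})" for n m
    using tree_rep_of_bool[OF is_tree_coordinate_tree[OF T(1), of "e n" "{m}"]]
    by (simp add: graph_trees_name_def coordinate_tree_def T(2) nth_default_def cong: conj_cong imp_cong)
  ultimately show ?thesis
    by (auto simp: seq_rep_eq_Some prod_rep_eq_Some graph_trees_def split: prod.split)
       (metis prod_decode_inverse)+
qed

text \<open>All paths carry the same entry at coordinate \<open>e n\<close>, so prescribing or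
  excluding a value there keeps all of them or none.\<close>

lemma infinite_paths_graph_trees:
  assumes "\<forall>y \<in> infinite_paths T. \<forall>n. y (e n) = x n"
  shows "infinite_paths (fst (graph_trees T e z)) =
      (if x (fst (prod_decode z)) = snd (prod_decode z) then {} else infinite_paths T)"
    and "infinite_paths (snd (graph_trees T e z)) =
      (if x (fst (prod_decode z)) = snd (prod_decode z) then infinite_paths T else {})"
  using assms by (auto simp: graph_trees_def infinite_paths_coordinate_tree split: prod.split)

lemma graph_trees_instance:
  assumes "is_tree T" "infinite_paths T \<noteq> {}"
    and "\<forall>y \<in> infinite_paths T. \<forall>n. y (e n) = x n"
  shows "graph_trees T e \<in> instances Delta11_CA"
proof -
  have "is_tree (fst (graph_trees T e z)) \<and> is_tree (snd (graph_trees T e z))" for z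
    using is_tree_coordinate_tree[OF assms(1)] by (simp add: graph_trees_def split: prod.split)
  with assms(2) show ?thesis
    by (simp add: Delta11_CA_def restrict_problem_def Sigma11_Sep_def case_prod_beta
        infinite_paths_graph_trees[OF assms(3)])
qed

lemma decode_graph_trees:
  assumes "infinite_paths T \<noteq> {}" "\<forall>y \<in> infinite_paths T. \<forall>n. y (e n) = x n"
    and "f \<in> solutions Sigma11_Sep (graph_trees T e)"
  shows "decode_graph f = Some x"
proof (rule decode_graph_eq)
  fix n m
  show "f (prod_encode (n, m)) = 1 \<longleftrightarrow> x n = m"
    using assms(1,3) by (auto simp: Sigma11_Sep_def case_prod_beta
        infinite_paths_graph_trees[of T e x, OF assms(2)] split: if_splits
        dest!: spec[of _ "prod_encode (n, m)"])
qed

section \<open>Unique choice reduces to the other problems\<close>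

text \<open>The given tree has exactly one path, and for each question exactly one of the two
  subtrees inherits it.\<close>

lemma UC_sW_reducible_Delta11_CA_minus: "UC \<le>\<^sub>s\<^sub>W Delta11_CA_minus"
proof (rule sW_reducibleI[OF computable_total[OF total_recursive_graph_trees_name[of "\<lambda>n. n"]]
      computable_decode_graph])
  fix A p assume "A \<in> instances UC" "in_rep UC p = Some A"
  then obtain T x where T: "tree_rep p = Some T" "infinite_paths T = {x}" "A = {x}"
    by (auto simp: UC_def closed_rep_def)
  then have x: "infinite_paths T \<noteq> {}" "\<forall>y \<in> infinite_paths T. \<forall>n. y n = x n"
    by auto
  have "graph_trees T (\<lambda>n. n) \<in> instances Delta11_CA_minus"
    using graph_trees_instance[OF tree_rep_eq_Some(1)[OF T(1)] x(1), of "\<lambda>n. n", OF x(2)] T(2)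
    by (simp add: Delta11_CA_minus_def restrict_problem_def case_prod_beta
        infinite_paths_graph_trees[of T _ x, OF x(2)])
  moreover have "decode_graph f = Some x" if "f \<in> solutions Delta11_CA_minus (graph_trees T (\<lambda>n. n))" for f
    using that decode_graph_trees[OF x(1), of "\<lambda>n. n", OF x(2)]
    by (simp add: Delta11_CA_minus_def Delta11_CA_def restrict_problem_def)
  ultimately show "\<exists>p' x'. Some (graph_trees_name (\<lambda>n. n) p) = Some p' \<and>
        in_rep Delta11_CA_minus p' = Some x' \<and> x' \<in> instances Delta11_CA_minus \<and>
        (\<forall>q y. out_rep Delta11_CA_minus q = Some y \<longrightarrow> y \<in> solutions Delta11_CA_minus x' \<longrightarrow>
          (\<exists>q' y'. decode_graph q = Some q' \<and> out_rep UC q' = Some y' \<and> y' \<in> solutions UC A))"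
    using graph_trees_name[OF T(1)] T(3)
    by (auto simp: Delta11_CA_minus_def Delta11_CA_def restrict_problem_def Sigma11_Sep_def
        cantor_rep_eq_Some UC_def baire_rep_def)
qed (intro recursive_intros)

text \<open>Paths code a witness at the even and the point \<open>x\<close> at the odd coordinates.
  There may be many witnesses, but the odd coordinates of all paths agree, which is all that the
  graph trees require.\<close>

lemma Sigma11_UC_sW_reducible_Sigma11_Sep: "Sigma11_UC \<le>\<^sub>s\<^sub>W Sigma11_Sep"
proof (rule sW_reducibleI[OF computable_total[OF total_recursive_graph_trees_name[of "\<lambda>n. 2 * n + 1"]]
      computable_decode_graph])
  fix A p assume "A \<in> instances Sigma11_UC" "in_rep Sigma11_UC p = Some A"
  then obtain T x where T: "tree_rep p = Some T" "{x. \<exists>g. baire_pair g x \<in> infinite_paths T} = {x}" "A = {x}"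
    by (auto simp: Sigma11_UC_def analytic_rep_def closed_rep_def)
  have "(\<lambda>n. y (2 * n + 1)) = x" if "y \<in> infinite_paths T" for y
  proof -
    \<comment> \<open>Every path is the pair of its even and its odd part, so its odd part belongs
      to the analytic singleton.\<close>
    have "baire_pair (\<lambda>n. y (2 * n)) (\<lambda>n. y (2 * n + 1)) = y"
      by (auto simp: baire_pair_def fun_eq_iff)
    with that T(2) show ?thesis by (metis (mono_tags, lifting) mem_Collect_eq singletonD)
  qed
  then have x: "infinite_paths T \<noteq> {}" "\<forall>y \<in> infinite_paths T. \<forall>n. y (2 * n + 1) = x n"
    using T(2) by auto
  have "graph_trees T (\<lambda>n. 2 * n + 1) \<in> instances Sigma11_Sep"
    using graph_trees_instance[OF tree_rep_eq_Some(1)[OF T(1)] x(1), of "\<lambda>n. 2 * n + 1", OF x(2)]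
    by (simp add: Delta11_CA_def restrict_problem_def)
  moreover note decode_graph_trees[OF x(1), of "\<lambda>n. 2 * n + 1", OF x(2)]
  ultimately show "\<exists>p' x'. Some (graph_trees_name (\<lambda>n. 2 * n + 1) p) = Some p' \<and>
        in_rep Sigma11_Sep p' = Some x' \<and> x' \<in> instances Sigma11_Sep \<and>
        (\<forall>q y. out_rep Sigma11_Sep q = Some y \<longrightarrow> y \<in> solutions Sigma11_Sep x' \<longrightarrow>
          (\<exists>q' y'. decode_graph q = Some q' \<and> out_rep Sigma11_UC q' = Some y' \<and> y' \<in> solutions Sigma11_UC A))"
    using graph_trees_name[OF T(1)] T(3)
    by (auto simp: Sigma11_Sep_def cantor_rep_eq_Some Sigma11_UC_def baire_rep_def)
qed (intro recursive_intros)

text \<open>Only the subtrees that prescribe a value are used: such a tree has one path if the value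
  is correct and none otherwise. Their names are the odd entries of
  \<open>graph_trees_name\<close>.\<close>

lemma UC_sW_reducible_Sigma11_CA_minus: "UC \<le>\<^sub>s\<^sub>W Sigma11_CA_minus"
proof -
  define h where "h = (\<lambda>p z. graph_trees_name (\<lambda>n. n) p
    (prod_encode (fst (prod_decode z), 2 * snd (prod_decode z) + 1)))"
  have "total_recursive h"
    unfolding h_def
    by (intro total_recursive_comp[OF total_recursive_graph_trees_name] recursive_intros)
  then show ?thesis
  proof (rule sW_reducibleI[OF computable_total computable_decode_graph])
    fix A p assume "A \<in> instances UC" "in_rep UC p = Some A"
    then obtain T x where T: "tree_rep p = Some T" "infinite_paths T = {x}" "A = {x}"
      by (auto simp: UC_def closed_rep_def)
    let ?X = "\<lambda>z. snd (graph_trees T (\<lambda>n. n) z)"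
    have "\<forall>y \<in> infinite_paths T. \<forall>n. y n = x n"
      using T(2) by simp
    note paths = infinite_paths_graph_trees(2)[of T "\<lambda>n. n" x, OF this]
    have "seq_rep tree_rep (h p) = Some ?X"
      using graph_trees_name[OF T(1), of "\<lambda>n. n"] by (simp add: seq_rep_eq_Some prod_rep_eq_Some h_def)
    moreover have "?X \<in> instances Sigma11_CA_minus"
      using is_tree_coordinate_tree[OF tree_rep_eq_Some(1)[OF T(1)]]
      by (simp add: Sigma11_CA_minus_def paths T(2)) (simp add: graph_trees_def split: prod.split)
    moreover have "decode_graph f = Some x" if "f \<in> solutions Sigma11_CA_minus ?X" for f
      using that by (intro decode_graph_eq) (simp add: Sigma11_CA_minus_def paths T(2))
    ultimately show "\<exists>p' x'. Some (h p) = Some p' \<and>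
        in_rep Sigma11_CA_minus p' = Some x' \<and> x' \<in> instances Sigma11_CA_minus \<and>
        (\<forall>q y. out_rep Sigma11_CA_minus q = Some y \<longrightarrow> y \<in> solutions Sigma11_CA_minus x' \<longrightarrow>
          (\<exists>q' y'. decode_graph q = Some q' \<and> out_rep UC q' = Some y' \<and> y' \<in> solutions UC A))"
      using T(3) by (auto simp: Sigma11_CA_minus_def cantor_rep_eq_Some UC_def baire_rep_def)
  qed
qed

text \<open>The part of a node that belongs to the second component of \<open>baire_pair\<close>.
  Since \<open>i < length \<sigma> div 2\<close> gives \<open>2 * i + 1 < length \<sigma>\<close>,
  the default is never read.\<close>

definition odd_entries :: "nat list \<Rightarrow> nat list" where
  "odd_entries \<sigma> = map (\<lambda>i. nth_default 0 \<sigma> (2 * i + 1)) [0..<length \<sigma> div 2]"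

lemma prefix_odd_entries:
  assumes "prefix \<sigma> \<tau>"
  shows "prefix (odd_entries \<sigma>) (odd_entries \<tau>)"
proof -
  from assms obtain \<rho> where \<rho>: "\<tau> = \<sigma> @ \<rho>"
    by (auto simp: prefix_def)
  have "map (\<lambda>i. nth_default 0 \<tau> (2 * i + 1)) [0..<length \<sigma> div 2] = odd_entries \<sigma>"
    by (auto simp: odd_entries_def \<rho> nth_default_append nth_default_nth)
  moreover have "length \<tau> div 2 = length \<sigma> div 2 + (length \<tau> div 2 - length \<sigma> div 2)"
    by (simp add: \<rho> div_le_mono)
  then obtain k where "[0..<length \<tau> div 2] = [0..<length \<sigma> div 2] @ k"
    by (metis upt_add_eq_append zero_le)
  ultimately have "odd_entries \<tau> = odd_entries \<sigma> @ map (\<lambda>i. nth_default 0 \<tau> (2 * i + 1)) k"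
    by (simp add: odd_entries_def[of \<tau>])
  then show ?thesis by simp
qed

text \<open>The tree is pulled back along \<open>odd_entries\<close>, which leaves the witness
  unconstrained; projecting it away returns the original closed set.\<close>

lemma UC_sW_reducible_Sigma11_UC: "UC \<le>\<^sub>s\<^sub>W Sigma11_UC"
proof -
  define h where "h = (\<lambda>(p :: baire) k. of_bool (p (list_encode (odd_entries (list_decode k))) = 1) :: nat)"
  have "total_recursive h"
    unfolding h_def odd_entries_def by (intro recursive_intros)
  then show ?thesis
  proof (rule sW_reducibleI[OF computable_total computable_Some])
    fix A p assume "A \<in> instances UC" "in_rep UC p = Some A"
    then obtain T x where T: "tree_rep p = Some T" "infinite_paths T = {x}" "A = {x}"
      by (auto simp: UC_def closed_rep_def)
    note tree = tree_rep_eq_Some[OF T(1)]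
    let ?T = "{\<sigma>. odd_entries \<sigma> \<in> T}"
    have "is_tree ?T"
      using tree(1) by (auto simp: is_tree_def intro: prefix_odd_entries)
    from tree_rep_of_bool[OF this] have "tree_rep (h p) = Some ?T"
      by (simp add: h_def tree(2))
    moreover have "(\<exists>g. baire_pair g y \<in> infinite_paths ?T) \<longleftrightarrow> y \<in> infinite_paths T" for y
    proof -
      have odd: "odd_entries (map (baire_pair g y) [0..<n]) = map y [0..<n div 2]" for g n
        by (auto simp: odd_entries_def nth_default_nth baire_pair_def)
      \<comment> \<open>Every level has the form \<open>n div 2\<close>, so halving loses no
        condition.\<close>
      have "(\<forall>n. P (n div 2)) \<longleftrightarrow> (\<forall>n. P n)" for P :: "nat \<Rightarrow> bool"
        by (metis nonzero_mult_div_cancel_left zero_neq_numeral)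
      from this[of "\<lambda>n. map y [0..<n] \<in> T"] show ?thesis
        unfolding infinite_paths_def by (simp add: odd)
    qed
    ultimately show "\<exists>p' x'. Some (h p) = Some p' \<and>
        in_rep Sigma11_UC p' = Some x' \<and> x' \<in> instances Sigma11_UC \<and>
        (\<forall>q y. out_rep Sigma11_UC q = Some y \<longrightarrow> y \<in> solutions Sigma11_UC x' \<longrightarrow>
          (\<exists>q' y'. Some q = Some q' \<and> out_rep UC q' = Some y' \<and> y' \<in> solutions UC A))"
      using T by (auto simp: Sigma11_UC_def analytic_rep_def closed_rep_def UC_def)
  qed
qed

section \<open>Well-founded games\<close>

text \<open>The rule is local: it involves the values of \<open>c\<close> only at \<open>u\<close>,
  at \<open>v\<close> and below \<open>v\<close>. A finite initial segment of \<open>c\<close>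
  therefore decides it, which makes the valuations the paths of a tree.\<close>

definition game_rule :: "(nat \<Rightarrow> nat \<Rightarrow> bool) \<Rightarrow> baire \<Rightarrow> nat \<Rightarrow> nat \<Rightarrow> bool" where
  "game_rule E c u v \<longleftrightarrow> (E u v \<and> c u = 0 \<longrightarrow> c v \<noteq> 0) \<and>
    (c u = Suc v \<longrightarrow> E u v \<and> c v = 0 \<and> (\<forall>w<v. E u w \<longrightarrow> c w \<noteq> 0))"

definition game_value :: "(nat \<Rightarrow> nat \<Rightarrow> bool) \<Rightarrow> baire \<Rightarrow> bool" where
  "game_value E c \<longleftrightarrow> (\<forall>u v. game_rule E c u v)"

lemma game_value_eq_0: "game_value E c \<Longrightarrow> c u = 0 \<longleftrightarrow> (\<forall>v. E u v \<longrightarrow> c v \<noteq> 0)"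
  by (cases "c u") (auto simp: game_value_def game_rule_def)

text \<open>Well-founded induction along the moves: the values at the successors determine whether
  \<open>u\<close> is lost, and minimality then determines the winning move recorded at
  \<open>u\<close>.\<close>

lemma game_value_unique:
  assumes wf: "wf {(v, u). E u v}" and c: "game_value E c" and d: "game_value E d"
  shows "c = d"
proof
  fix u
  show "c u = d u"
  proof (induction u rule: wf_induct_rule[OF wf])
    case (1 u)
    then have eq: "c v = d v" if "E u v" for v using that by simp
    show ?case
    proof (cases "c u")
      case 0
      then show ?thesis using game_value_eq_0[OF c] game_value_eq_0[OF d] eq by metis
    next
      case (Suc v)
      then have v: "E u v" "c v = 0" "\<forall>w<v. E u w \<longrightarrow> c w \<noteq> 0"
        using c unfolding game_value_def game_rule_def by blast+
      then have "d u \<noteq> 0" using game_value_eq_0[OF d] eq by metis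
      then obtain w where "d u = Suc w" using not0_implies_Suc by blast
      moreover from this have "E u w" "d w = 0" "\<forall>v<w. E u v \<longrightarrow> d v \<noteq> 0"
        using d unfolding game_value_def game_rule_def by blast+
      ultimately show ?thesis using v eq Suc by (metis nat_neq_iff)
    qed
  qed
qed

lemma game_value_exists:
  assumes wf: "wf {(v, u). E u v}"
  shows "\<exists>c. game_value E c"
proof -
  define F where "F = (\<lambda>(c :: baire) u. if \<exists>v. E u v \<and> c v = 0 then Suc (LEAST v. E u v \<and> c v = 0) else 0)"
  define c where "c = wfrec {(v, u). E u v} F"
  \<comment> \<open>\<open>F\<close> consults \<open>c\<close> only at successors of
    \<open>u\<close>, where cutting changes nothing.\<close>
  have "F (cut c {(v, u). E u v} u) u = F c u" for u
    unfolding F_def by (simp add: cut_apply cong: conj_cong if_cong)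
  then have c: "c u = F c u" for u
    using wfrec[OF wf, of F u] by (simp add: c_def)
  have "E u v \<Longrightarrow> c u = 0 \<Longrightarrow> c v \<noteq> 0" for u v
    using c[of u] by (auto simp: F_def split: if_splits)
  moreover have "E u v \<and> c v = 0 \<and> (\<forall>w<v. E u w \<longrightarrow> c w \<noteq> 0)" if "c u = Suc v" for u v
  proof -
    have ex: "\<exists>v. E u v \<and> c v = 0" and v: "v = (LEAST v. E u v \<and> c v = 0)"
      using that c[of u] by (auto simp: F_def split: if_splits)
    have "E u v \<and> c v = 0"
      unfolding v using LeastI_ex[OF ex] .
    moreover have "\<not> (E u w \<and> c w = 0)" if "w < v" for w
      using that unfolding v by (rule not_less_Least)
    ultimately show ?thesis by simp
  qed
  ultimately show ?thesis unfolding game_value_def game_rule_def by blast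
qed

definition game_tree :: "(nat \<Rightarrow> nat \<Rightarrow> bool) \<Rightarrow> nat list set" where
  "game_tree E =
    {\<sigma>. \<forall>u<length \<sigma>. \<forall>v<length \<sigma>. game_rule E (nth_default 0 \<sigma>) u v}"

lemma is_tree_game_tree: "is_tree (game_tree E)"
  unfolding is_tree_def
proof (intro ballI allI impI)
  fix \<sigma> \<tau> assume \<sigma>: "\<sigma> \<in> game_tree E" and \<tau>: "prefix \<tau> \<sigma>"
  have "nth_default 0 \<tau> u = nth_default 0 \<sigma> u" if "u < length \<tau>" for u
    using \<tau> that prefix_iff_nth_default[of \<tau> \<sigma>] by blast
  then have "game_rule E (nth_default 0 \<tau>) u v \<longleftrightarrow> game_rule E (nth_default 0 \<sigma>) u v"
    if "u < length \<tau>" "v < length \<tau>" for u v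
    using that by (simp add: game_rule_def)
  moreover have "length \<tau> \<le> length \<sigma>" using \<tau> by (rule prefix_length_le)
  ultimately show "\<tau> \<in> game_tree E"
    using \<sigma> by (simp add: game_tree_def)
qed

lemma infinite_paths_game_tree: "infinite_paths (game_tree E) = {c. game_value E c}"
proof -
  have "game_rule E (nth_default 0 (map c [0..<n])) u v \<longleftrightarrow> game_rule E c u v"
    if "u < n" "v < n" for c n u v
    using that by (simp add: game_rule_def nth_default_nth)
  then have "map c [0..<n] \<in> game_tree E \<longleftrightarrow> (\<forall>u<n. \<forall>v<n. game_rule E c u v)" for c n
    by (simp add: game_tree_def)
  moreover have "(\<forall>n. \<forall>u<n. \<forall>v<n. game_rule E c u v) \<longleftrightarrow> (\<forall>u v. game_rule E c u v)" for c
  proof (intro iffI allI)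
    fix u v assume *: "\<forall>n. \<forall>u<n. \<forall>v<n. game_rule E c u v"
    have "u < Suc (max u v)" "v < Suc (max u v)" by simp_all
    with * show "game_rule E c u v" by blast
  qed simp
  ultimately show ?thesis
    by (simp add: infinite_paths_def game_value_def)
qed

text \<open>Every instance becomes a game whose unique valuation is found by \<open>UC\<close>; the
  answer at \<open>n\<close> is 1 iff the player to move at \<open>root n\<close> loses. As
  \<open>root\<close> does not depend on the instance, the valuation alone suffices to read off the
  answer.\<close>

lemma sW_reducible_UC_by_game:
  assumes E: "decidable (\<lambda>p z. E p (fst (prod_decode z)) (snd (prod_decode z)))"
    and root: "total_recursive (\<lambda>p. root)"
    and out: "out_rep f = cantor_rep"
    and wf: "\<And>x p. x \<in> instances f \<Longrightarrow> in_rep f p = Some x \<Longrightarrow> wf {(v, u). E p u v}"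
    and sol: "\<And>x p c. x \<in> instances f \<Longrightarrow> in_rep f p = Some x \<Longrightarrow> game_value (E p) c \<Longrightarrow>
      (\<lambda>n. of_bool (c (root n) = 0)) \<in> solutions f x"
  shows "f \<le>\<^sub>s\<^sub>W UC"
proof -
  define h where "h = (\<lambda>p k. of_bool (list_decode k \<in> game_tree (E p)) :: nat)"
  define K where "K = (\<lambda>(c :: baire) n. of_bool (c (root n) = 0) :: nat)"
  have E': "decidable (\<lambda>p n. E p (a p n) (b p n))" if "total_recursive a" "total_recursive b" for a b
    using decidable_comp[OF E total_recursive_pair[OF that]] by simp
  have "total_recursive h"
    unfolding h_def game_tree_def game_rule_def mem_Collect_eq by (intro recursive_intros E')
  moreover have "total_recursive K"
    unfolding K_def by (intro recursive_intros total_recursive_comp[OF root])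
  ultimately show ?thesis
  proof (rule sW_reducibleI[OF computable_total computable_total])
    fix x p assume x: "x \<in> instances f" "in_rep f p = Some x"
    obtain c where c: "game_value (E p) c"
      using game_value_exists[OF wf[OF x]] by blast
    then have "infinite_paths (game_tree (E p)) = {c}"
      using game_value_unique[OF wf[OF x]] by (auto simp: infinite_paths_game_tree)
    moreover have "tree_rep (h p) = Some (game_tree (E p))"
      unfolding h_def by (rule tree_rep_of_bool[OF is_tree_game_tree])
    moreover have "cantor_rep (K c) = Some (K c)"
      by (auto simp: cantor_rep_eq_Some K_def)
    moreover have "K c \<in> solutions f x"
      unfolding K_def by (rule sol[OF x c])
    ultimately show "\<exists>p' x'. Some (h p) = Some p' \<and> in_rep UC p' = Some x' \<and> x' \<in> instances UC \<and>
        (\<forall>q y. out_rep UC q = Some y \<longrightarrow> y \<in> solutions UC x' \<longrightarrow>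
          (\<exists>q' y'. Some (K q) = Some q' \<and> out_rep f q' = Some y' \<and> y' \<in> solutions f x))"
      by (auto simp: UC_def closed_rep_def baire_rep_def out)
  qed
qed

section \<open>Comparison games\<close>

definition child :: "nat list \<Rightarrow> nat list \<Rightarrow> bool" where
  "child \<sigma> \<tau> \<longleftrightarrow> prefix \<sigma> \<tau> \<and> length \<tau> = Suc (length \<sigma>)"

text \<open>The union of the chain is the path. Membership is asked of the later nodes because a
  play may start at any node, while each node moved to lies in the tree.\<close>

lemma infinite_path_of_chain:
  assumes tree: "is_tree T" and step: "\<And>i. child (\<sigma> i) (\<sigma> (Suc i))" and mem: "\<And>i. \<sigma> (Suc i) \<in> T"
  obtains x where "x \<in> infinite_paths T" "map x [0..<length (\<sigma> 0)] = \<sigma> 0"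
proof
  \<comment> \<open>The node \<open>\<sigma> (Suc k)\<close> has length at least
    \<open>Suc k\<close>, so its entry \<open>k\<close> exists.\<close>
  define x where "x = (\<lambda>k. \<sigma> (Suc k) ! k)"
  have len: "length (\<sigma> i) = length (\<sigma> 0) + i" for i
    using step by (induction i) (auto simp: child_def)
  have mono: "prefix (\<sigma> i) (\<sigma> j)" if "i \<le> j" for i j
    using that
  proof (induction rule: dec_induct)
    case (step j)
    then show ?case using assms(2)[of j] by (auto simp: child_def intro: prefix_order.trans)
  qed simp
  have nth_eq: "\<sigma> i ! k = \<sigma> j ! k" if "i \<le> j" "k < length (\<sigma> i)" for i j k
    using mono[OF that(1)] that(2) by (auto simp: prefix_def nth_append)
  have x: "\<sigma> i ! k = x k" if "k < length (\<sigma> i)" for i k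
  proof (cases "i \<le> Suc k")
    case True
    then show ?thesis using nth_eq that by (simp add: x_def)
  next
    case False
    then show ?thesis using nth_eq[of "Suc k" i k] len[of "Suc k"] by (simp add: x_def)
  qed
  have eq: "map x [0..<length (\<sigma> i)] = \<sigma> i" for i
    using x by (intro nth_equalityI) auto
  then show "map x [0..<length (\<sigma> 0)] = \<sigma> 0" .
  from eq have "map x [0..<length (\<sigma> (Suc n))] \<in> T" for n
    using mem by simp
  moreover have "prefix (map x [0..<n]) (map x [0..<length (\<sigma> (Suc n))])" for n
  proof -
    have "map x [0..<n] = take n (map x [0..<length (\<sigma> (Suc n))])"
      using len[of "Suc n"] by (simp add: take_map)
    then show ?thesis by (metis take_is_prefix)
  qed
  ultimately show "x \<in> infinite_paths T"
    using tree unfolding is_tree_def infinite_paths_def by blast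
qed

definition position :: "nat \<Rightarrow> nat \<Rightarrow> nat list \<Rightarrow> nat list \<Rightarrow> nat" where
  "position n b s t = prod_encode (n, prod_encode (b, prod_encode (list_encode s, list_encode t)))"

text \<open>The codings involved are bijections, so every number is a position and no case of
  invalid codes arises.\<close>

lemma position_cases: obtains n b s t where "u = position n b s t"
  unfolding position_def by (metis list_decode_inverse prod_decode_inverse prod.exhaust)

lemma position_eq_iff [simp]:
  "position n b s t = position n' b' s' t' \<longleftrightarrow> n = n' \<and> b = b' \<and> s = s' \<and> t = t'"
  by (simp add: position_def list_encode_eq)


text \<open>
  In \<^term>\<open>position n b s t\<close> the player to move stands at the node \<open>s\<close> and the opponent at \<open>t\<close>; a move
  passes to a child of \<open>s\<close> and swaps the two roles.  The counter \<open>b\<close> of the moves made so far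
  tells, by its parity, whose turn it is.
\<close>

locale comparison_game =
  fixes E :: "nat \<Rightarrow> nat \<Rightarrow> bool"
    and X :: "nat \<Rightarrow> nat \<Rightarrow> nat list set"
    and b0 :: nat
    and R :: "nat list \<Rightarrow> nat list \<Rightarrow> bool"
  assumes step: "E (position n b s t) (position n' b' s' t') \<Longrightarrow> n' = n \<and> b' = Suc b"
    and move: "b0 \<le> b \<Longrightarrow> E (position n b s t) (position n (Suc b) s' t') \<longleftrightarrow>
      s' = t \<and> R s t \<and> child s t' \<and> t' \<in> X n b"
    and period: "X n (Suc (Suc b)) = X n b"
    and tree: "is_tree (X n b)"
    and sym: "R s t \<Longrightarrow> R t s"
    and mono: "R s t \<Longrightarrow> prefix s s' \<Longrightarrow> R s' t"
    and separated: "x \<in> infinite_paths (X n b) \<Longrightarrow> y \<in> infinite_paths (X n (Suc b)) \<Longrightarrow>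
      \<not> R (map x [0..<i]) (map y [0..<j])"
begin

text \<open>After the opening, the nodes of each player in an infinite play form a chain and hence a
  path of that player's tree. The relation \<open>R\<close>, demanded at every such move, would then
  hold between initial segments of the two paths, against \<open>separated\<close>.\<close>

lemma wf_moves: "wf {(v, u). E u v}"
  unfolding wf_iff_no_infinite_down_chain
proof
  assume "\<exists>f. \<forall>i. (f (Suc i), f i) \<in> {(v, u). E u v}"
  then obtain f where f: "\<And>i. E (f i) (f (Suc i))" by blast
  have "\<forall>i. \<exists>z. f i = (case z of (n, b, s, t) \<Rightarrow> position n b s t)"
    by (metis position_cases old.prod.case)
  then obtain z where z: "\<And>i. f i = (case z i of (n, b, s, t) \<Rightarrow> position n b s t)"
    by metis
  define n b s t where "n i = fst (z i)" and "b i = fst (snd (z i))"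
    and "s i = fst (snd (snd (z i)))" and "t i = snd (snd (snd (z i)))" for i
  have f_eq: "f i = position (n i) (b i) (s i) (t i)" for i
    by (simp add: z n_def b_def s_def t_def case_prod_beta)
  have nb: "n (Suc i) = n i \<and> b (Suc i) = Suc (b i)" for i
    using f[of i] step unfolding f_eq by blast
  have n: "n i = n 0" for i
    using nb by (induction i) simp_all
  have b: "b i = b 0 + i" for i
    using nb by (induction i) simp_all
  \<comment> \<open>The counter at stage \<open>i\<close> is at least \<open>i\<close>, so from
    stage \<open>b0\<close> on the opening is over.\<close>
  have move_i: "s (Suc i) = t i \<and> R (s i) (t i) \<and> child (s i) (t (Suc i)) \<and> t (Suc i) \<in> X (n 0) (b i)"
    if "b0 \<le> i" for i
    using f[of i] move[of "b i" "n i" "s i" "t i" "s (Suc i)" "t (Suc i)"] nb[of i] n[of i] that b[of i]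
    unfolding f_eq by simp
  have X: "X (n 0) (b (i + 2 * j)) = X (n 0) (b i)" for i j
    using b[of i] b[of "i + 2 * _"] by (induction j) (simp_all add: period nb)
  \<comment> \<open>Roles swap at each move, so every second position shows the node of the same
    player.\<close>
  have chain: "child (s i) (s (Suc (Suc i)))" "s (Suc (Suc i)) \<in> X (n 0) (b i)" if "b0 \<le> i" for i
    using move_i[of i] move_i[of "Suc i"] that by auto
  have path: "\<exists>x. x \<in> infinite_paths (X (n 0) (b i)) \<and> map x [0..<length (s i)] = s i" if "b0 \<le> i" for i
    by (rule infinite_path_of_chain[OF tree, of "\<lambda>j. s (i + 2 * j)" "n 0" "b i"])
      (use chain[of "i + 2 * j" for j] that X in auto)
  obtain x where x: "x \<in> infinite_paths (X (n 0) (b b0))" "map x [0..<length (s b0)] = s b0"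
    using path by blast
  obtain y where y: "y \<in> infinite_paths (X (n 0) (b (Suc b0)))" "map y [0..<length (s (Suc b0))] = s (Suc b0)"
    using path[of "Suc b0"] by auto
  have "\<not> R (s b0) (s (Suc b0))"
    using separated[OF x(1), of y] x(2) y nb by metis
  then show False using move_i[of b0] by simp
qed

lemma moves_position:
  assumes "b0 \<le> b"
  shows "E (position n b s t) v \<longleftrightarrow>
    (\<exists>t'. v = position n (Suc b) t t' \<and> R s t \<and> child s t' \<and> t' \<in> X n b)"
proof
  assume E: "E (position n b s t) v"
  obtain n' b' s' t' where v: "v = position n' b' s' t'" by (rule position_cases)
  with E step have "n' = n" "b' = Suc b" by blast+
  with E v assms show "\<exists>t'. v = position n (Suc b) t t' \<and> R s t \<and> child s t' \<and> t' \<in> X n b"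
    by (auto simp: move)
qed (use assms move in auto)

text \<open>Unlike \<open>moves_position\<close>, this also applies to the opening moves.\<close>

lemma game_value_position_eq_0:
  assumes "game_value E c"
  shows "c (position n b s t) = 0 \<longleftrightarrow>
    (\<forall>s' t'. E (position n b s t) (position n (Suc b) s' t') \<longrightarrow> c (position n (Suc b) s' t') \<noteq> 0)"
  unfolding game_value_eq_0[OF assms, of "position n b s t"]
proof (intro iffI allI impI)
  fix v
  assume *: "\<forall>s' t'. E (position n b s t) (position n (Suc b) s' t') \<longrightarrow> c (position n (Suc b) s' t') \<noteq> 0"
    and E: "E (position n b s t) v"
  obtain n' b' s' t' where v: "v = position n' b' s' t'" by (rule position_cases)
  then have "n' = n" "b' = Suc b" using E step by blast+
  then show "c v \<noteq> 0" using * E v by simp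
qed simp

text \<open>The strategy is to follow \<open>x\<close>: it always provides a next move, and
  well-foundedness ends the play, so the opponent gets stuck. Both claims, for either player to
  move, are proved in one induction; \<open>mono\<close> and \<open>sym\<close> preserve
  \<open>R\<close> throughout.\<close>

lemma infinite_path_wins:
  assumes c: "game_value E c" and x: "x \<in> infinite_paths (X n b)"
    and "b0 \<le> b" "R (map x [0..<l]) t"
  shows "c (position n b (map x [0..<l]) t) \<noteq> 0"
    and "c (position n (Suc b) t (map x [0..<l])) = 0"
proof -
  have "\<forall>b l t. b0 \<le> b \<longrightarrow> x \<in> infinite_paths (X n b) \<longrightarrow> R (map x [0..<l]) t \<longrightarrow>
      (u = position n b (map x [0..<l]) t \<longrightarrow> c u \<noteq> 0) \<and>
      (u = position n (Suc b) t (map x [0..<l]) \<longrightarrow> c u = 0)" for u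
  proof (induction u rule: wf_induct_rule[OF wf_moves])
    case (1 u)
    show ?case
    proof (intro allI impI conjI)
      fix b l t
      assume b: "b0 \<le> b" and x: "x \<in> infinite_paths (X n b)" and R: "R (map x [0..<l]) t"
      {
        assume u: "u = position n b (map x [0..<l]) t"
        let ?s = "map x [0..<Suc l]"
        have "child (map x [0..<l]) ?s" "?s \<in> X n b"
          using x by (auto simp: child_def infinite_paths_def simp del: upt_Suc) (simp add: prefix_def)
        then have "E u (position n (Suc b) t ?s)"
          unfolding u using moves_position[OF b] R by blast
        moreover have "R ?s t" using mono[OF R] by (simp add: prefix_def)
        ultimately have "c (position n (Suc b) t ?s) = 0" using 1 b x by blast
        with \<open>E u _\<close> show "c u \<noteq> 0" using c game_value_eq_0 by blast
      }
      {
        assume u: "u = position n (Suc b) t (map x [0..<l])"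
        have "c v \<noteq> 0" if E: "E u v" for v
        proof -
          obtain t' where v: "v = position n (Suc (Suc b)) (map x [0..<l]) t'" and "child t t'"
            using E b unfolding u by (auto simp: moves_position)
          then have "R (map x [0..<l]) t'"
            using R sym mono unfolding child_def by blast
          then show ?thesis using 1[of v] E v b x by (simp add: period)
        qed
        then show "c u = 0" using c game_value_eq_0 by blast
      }
    qed
  qed
  then show "c (position n b (map x [0..<l]) t) \<noteq> 0"
    and "c (position n (Suc b) t (map x [0..<l])) = 0"
    using assms(2-) by blast+
qed

text \<open>If both players use the same tree, the moves after the opening are the same at every
  count. This allows comparing positions reached after different numbers of moves.\<close>

lemma count_irrelevant:
  assumes c: "game_value E c" and const: "\<And>b. X n (Suc b) = X n b" and "b0 \<le> b"
  shows "c (position n (Suc b) s t) = 0 \<longleftrightarrow> c (position n b s t) = 0"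
proof -
  have "\<forall>b s t. b0 \<le> b \<longrightarrow> u = position n b s t \<longrightarrow>
      (c (position n (Suc b) s t) = 0 \<longleftrightarrow> c (position n b s t) = 0)" for u
  proof (induction u rule: wf_induct_rule[OF wf_moves])
    case (1 u)
    show ?case
    proof (intro allI impI)
      fix b s t assume b: "b0 \<le> b" and u: "u = position n b s t"
      have "c (position n (Suc (Suc b)) t t') = 0 \<longleftrightarrow> c (position n (Suc b) t t') = 0"
        if "R s t" "child s t'" "t' \<in> X n b" for t'
        using "1.IH"[rule_format, of "position n (Suc b) t t'" "Suc b" t t'] that b move[OF b]
        by (simp add: u)
      then show "c (position n (Suc b) s t) = 0 \<longleftrightarrow> c (position n b s t) = 0"
        using b by (subst (1 2) game_value_position_eq_0[OF c]) (auto simp: move const)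
    qed
  qed
  from this[rule_format, OF assms(3) refl] show ?thesis .
qed

text \<open>Suppose moving first wins from either side, by moves to \<open>s'\<close> and
  \<open>t'\<close>. In each play the other player may answer with the other of these nodes, so from
  \<open>s'\<close> and \<open>t'\<close> moving first again wins from either side: an infinite
  descent.\<close>

lemma not_both_win:
  assumes c: "game_value E c" and const: "\<And>b. X n (Suc b) = X n b"
    and "b0 \<le> b" "R s t" "c (position n b s t) \<noteq> 0"
  shows "c (position n b t s) = 0"
proof -
  have "\<forall>b s t. b0 \<le> b \<longrightarrow> R s t \<longrightarrow> u = position n b s t \<longrightarrow>
      c (position n b s t) = 0 \<or> c (position n b t s) = 0" for u
  \<comment> \<open>Each round of the descent takes two moves, hence the transitive closure.\<close>
  proof (induction u rule: wf_induct_rule[OF wf_trancl[OF wf_moves]])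
    case (1 u)
    show ?case
    proof (intro allI impI, rule ccontr)
      fix b s t
      assume b: "b0 \<le> b" and R: "R s t" and u: "u = position n b s t"
        and win: "\<not> (c (position n b s t) = 0 \<or> c (position n b t s) = 0)"
      obtain s' where s': "child s s'" "s' \<in> X n b" "c (position n (Suc b) t s') = 0"
        using win b game_value_eq_0[OF c, of "position n b s t"] by (auto simp: moves_position)
      obtain t' where t': "child t t'" "t' \<in> X n b" "c (position n (Suc b) s t') = 0"
        using win b game_value_eq_0[OF c, of "position n b t s"] by (auto simp: moves_position)
      have R': "R s' t" "R s t'" "R s' t'" "R t s'" "R t' s'"
        using R s'(1) t'(1) sym mono unfolding child_def by blast+
      have E1: "E u (position n (Suc b) t s')"
        unfolding u using s' R b by (auto simp: moves_position)
      have E2: "E (position n (Suc b) t s') (position n (Suc (Suc b)) s' t')"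
        using t' R' b const by (auto simp: moves_position)
      have E3: "E (position n (Suc b) s t') (position n (Suc (Suc b)) t' s')"
        using s' R' b const by (auto simp: moves_position)
      have "c (position n (Suc (Suc b)) s' t') \<noteq> 0" "c (position n (Suc (Suc b)) t' s') \<noteq> 0"
        using E2 E3 s'(3) t'(3) game_value_eq_0[OF c] by blast+
      moreover have "(position n (Suc (Suc b)) s' t', u) \<in> {(v, u). E u v}\<^sup>+"
        using E1 E2 by (auto intro: trancl_into_trancl)
      ultimately show False
        using "1.IH"[rule_format, of "position n (Suc (Suc b)) s' t'" "Suc (Suc b)" s' t'] R'(3) b
        by simp
    qed
  qed
  from this[rule_format, OF assms(3,4) refl] assms(5) show ?thesis by simp
qed

end

section \<open>Components of a position\<close>

definition tag :: "nat \<Rightarrow> nat" where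
  "tag u = fst (prod_decode u)"

definition count :: "nat \<Rightarrow> nat" where
  "count u = fst (prod_decode (snd (prod_decode u)))"

definition mover :: "nat \<Rightarrow> nat" where
  "mover u = fst (prod_decode (snd (prod_decode (snd (prod_decode u)))))"

definition opponent :: "nat \<Rightarrow> nat" where
  "opponent u = snd (prod_decode (snd (prod_decode (snd (prod_decode u)))))"

lemma position_simps [simp]:
  "tag (position n b s t) = n"
  "count (position n b s t) = b"
  "mover (position n b s t) = list_encode s"
  "opponent (position n b s t) = list_encode t"
  by (simp_all add: position_def tag_def count_def mover_def opponent_def)

lemma total_recursive_position [recursive_intros]:
  assumes "total_recursive a"
  shows "total_recursive (\<lambda>p n. tag (a p n))" "total_recursive (\<lambda>p n. count (a p n))"
    "total_recursive (\<lambda>p n. mover (a p n))" "total_recursive (\<lambda>p n. opponent (a p n))"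
  unfolding tag_def count_def mover_def opponent_def by (intro recursive_intros assms)+

section \<open>Separation reduces to unique choice\<close>

text \<open>In a name of a pair of trees the even entries describe the first and the odd entries the
  second, so the parity of the count selects the tree of the player to move.\<close>

definition separation_move :: "baire \<Rightarrow> nat \<Rightarrow> nat \<Rightarrow> bool" where
  "separation_move p u v \<longleftrightarrow> tag v = tag u \<and> count v = Suc (count u) \<and> mover v = opponent u \<and>
    child (list_decode (mover u)) (list_decode (opponent v)) \<and>
    p (prod_encode (tag u, 2 * opponent v + count u mod 2)) = 1"

lemma Sigma11_Sep_sW_reducible_UC: "Sigma11_Sep \<le>\<^sub>s\<^sub>W UC"
\<comment> \<open>The count 2 is even, so the player of the first tree begins; being the successor
  of 1, it also admits the second part of \<open>infinite_path_wins\<close> for the other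
  player.\<close>
proof (rule sW_reducible_UC_by_game[where E = separation_move and root = "\<lambda>n. position n 2 [] []"])
  show "decidable (\<lambda>p z. separation_move p (fst (prod_decode z)) (snd (prod_decode z)))"
    unfolding separation_move_def child_def by (intro recursive_intros)
  show "total_recursive (\<lambda>p n. position n 2 [] [])"
    unfolding position_def by (intro recursive_intros)
  show "out_rep Sigma11_Sep = cantor_rep"
    by (simp add: Sigma11_Sep_def)
  fix Z p assume Z: "Z \<in> instances Sigma11_Sep" "in_rep Sigma11_Sep p = Some Z"
  define X where "X n b = (if even b then fst (Z n) else snd (Z n))" for n and b :: nat
  have name: "tree_rep (\<lambda>k. p (prod_encode (n, 2 * k + b mod 2))) = Some (X n b)" for n b
    using Z(2) by (auto simp: Sigma11_Sep_def seq_rep_eq_Some prod_rep_eq_Some X_def odd_iff_mod_2_eq_one)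
  note mem = tree_rep_eq_Some(2)[OF name]
  have disjoint: "infinite_paths (fst (Z n)) = {} \<or> infinite_paths (snd (Z n)) = {}" for n
    using Z(1) by (simp add: Sigma11_Sep_def case_prod_beta)
  \<comment> \<open>There is no opening and no condition on the two nodes; \<open>separated\<close>
    holds because one of the trees has no path.\<close>
  interpret comparison_game "separation_move p" X 0 "\<lambda>s t. True"
  proof
    show "is_tree (X n b)" for n b using tree_rep_eq_Some(1)[OF name] .
    show "\<not> True" if "x \<in> infinite_paths (X n b)" "y \<in> infinite_paths (X n (Suc b))" for x y n b
      using that disjoint[of n] by (auto simp: X_def split: if_splits)
    show "separation_move p (position n b s t) (position n (Suc b) s' t') \<longleftrightarrow>
        s' = t \<and> True \<and> child s t' \<and> t' \<in> X n b" for n b s t s' t'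
      by (simp add: separation_move_def mem list_encode_eq)
  qed (auto simp: separation_move_def X_def)
  show "wf {(v, u). separation_move p u v}" by (rule wf_moves)
  fix c assume "game_value (separation_move p) c"
  note wins = infinite_path_wins[OF this, where l = 0 and t = "[]", simplified]
  have "c (position n 2 [] []) \<noteq> 0" if "infinite_paths (fst (Z n)) \<noteq> {}" for n
    using wins(1)[of _ n 2] that by (auto simp: X_def)
  moreover have "c (position n 2 [] []) = 0" if "infinite_paths (snd (Z n)) \<noteq> {}" for n
    using wins(2)[of _ n 1] that by (auto simp: X_def numeral_2_eq_2)
  ultimately show "(\<lambda>n. of_bool (c (position n 2 [] []) = 0)) \<in> solutions Sigma11_Sep Z"
    by (auto simp: Sigma11_Sep_def case_prod_beta)
qed

section \<open>Comprehension for unique paths reduces to unique choice\<close>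

text \<open>
  In a tree with at most one path, a node on the path wins the comparison game against every other
  node of its level.  Conversely, if at every level some node wins against all the others, then
  these nodes form a path.  The first three moves play out the quantifiers ``for every level there
  is a node such that for every other node'', the level being given as the length of \<open>s\<close>.
\<close>

definition unique_path_move :: "baire \<Rightarrow> nat \<Rightarrow> nat \<Rightarrow> bool" where
  "unique_path_move p u v \<longleftrightarrow> tag v = tag u \<and> count v = Suc (count u) \<and>
    (count u = 0 \<or>
     count u = 1 \<and> length (list_decode (mover v)) = length (list_decode (mover u)) \<and>
       p (prod_encode (tag u, mover v)) = 1 \<or>
     count u = 2 \<and> mover v = mover u \<and> opponent v \<noteq> mover u \<and>
       length (list_decode (opponent v)) = length (list_decode (mover u)) \<and>
       p (prod_encode (tag u, opponent v)) = 1 \<or>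
     3 \<le> count u \<and> mover v = opponent u \<and>
       \<not> prefix (list_decode (mover u)) (list_decode (opponent u)) \<and>
       \<not> prefix (list_decode (opponent u)) (list_decode (mover u)) \<and>
       child (list_decode (mover u)) (list_decode (opponent v)) \<and>
       p (prod_encode (tag u, opponent v)) = 1)"

lemma Sigma11_CA_minus_sW_reducible_UC: "Sigma11_CA_minus \<le>\<^sub>s\<^sub>W UC"
\<comment> \<open>The player to move at the root picks the level and thus disputes that a path
  exists; this player loses, and the answer is 1, iff there is one.\<close>
proof (rule sW_reducible_UC_by_game[where E = unique_path_move and root = "\<lambda>n. position n 0 [] []"])
  show "decidable (\<lambda>p z. unique_path_move p (fst (prod_decode z)) (snd (prod_decode z)))"
    unfolding unique_path_move_def child_def by (intro recursive_intros)
  show "total_recursive (\<lambda>p n. position n 0 [] [])"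
    unfolding position_def by (intro recursive_intros)
  show "out_rep Sigma11_CA_minus = cantor_rep"
    by (simp add: Sigma11_CA_minus_def)
  fix T p assume T: "T \<in> instances Sigma11_CA_minus" "in_rep Sigma11_CA_minus p = Some T"
  have name: "tree_rep (\<lambda>k. p (prod_encode (n, k))) = Some (T n)" for n
    using T(2) by (auto simp: Sigma11_CA_minus_def seq_rep_eq_Some)
  note tree = tree_rep_eq_Some(1)[OF name] and mem = tree_rep_eq_Some(2)[OF name]
  have unique: "x = y" if "x \<in> infinite_paths (T n)" "y \<in> infinite_paths (T n)" for x y n
  proof -
    have "finite (infinite_paths (T n))" "card (infinite_paths (T n)) \<le> Suc 0"
      using T(1) by (auto simp: Sigma11_CA_minus_def)
    with that show ?thesis by (meson card_le_Suc0_iff_eq)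
  qed
  have E: "unique_path_move p (position n b s t) (position n' b' s' t') \<longleftrightarrow> n' = n \<and> b' = Suc b \<and>
    (b = 0 \<or> b = 1 \<and> length s' = length s \<and> s' \<in> T n \<or>
     b = 2 \<and> s' = s \<and> t' \<noteq> s \<and> length t' = length s \<and> t' \<in> T n \<or>
     3 \<le> b \<and> s' = t \<and> s \<parallel> t \<and> child s t' \<and> t' \<in> T n)" for n b s t n' b' s' t'
    by (auto simp: unique_path_move_def mem parallel_def list_encode_eq)
  \<comment> \<open>The opening takes three moves. Play goes on only between incomparable nodes,
    whereas any two paths here coincide and have comparable initial segments.\<close>
  interpret comparison_game "unique_path_move p" "\<lambda>n b. T n" 3 "(\<parallel>)"
  proof
    show "s' \<parallel> t" if "s \<parallel> t" "prefix s s'" for s t s' :: "nat list"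
      using that prefix_order.trans prefix_same_cases by (metis parallel_def)
    show "\<not> map x [0..<i] \<parallel> map y [0..<j]" if "x \<in> infinite_paths (T n)" "y \<in> infinite_paths (T n)"
      for x y n i j
    proof -
      have "prefix (map x [0..<i]) (map x [0..<j])" if "i \<le> j" for i j
        using that take_is_prefix[of i "map x [0..<j]"] by (simp add: take_map)
      then show ?thesis
        using unique[OF that] by (metis nat_le_linear parallel_def)
    qed
  qed (auto simp: E tree parallel_def)
  show "wf {(v, u). unique_path_move p u v}" by (rule wf_moves)
  fix c assume c: "game_value (unique_path_move p) c"
  define beats where "beats n s t \<longleftrightarrow> c (position n 3 s t) \<noteq> 0" for n s t
  define best where "best n s \<longleftrightarrow> s \<in> T n \<and>
    (\<forall>t \<in> T n. length t = length s \<longrightarrow> t \<noteq> s \<longrightarrow> beats n s t)" for n s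
  note c0 = game_value_position_eq_0[OF c]
  have "c (position n 2 s t) = 0 \<longleftrightarrow> (\<forall>t \<in> T n. length t = length s \<longrightarrow> t \<noteq> s \<longrightarrow> beats n s t)" for n s t
    by (subst c0) (auto simp: E beats_def)
  then have "c (position n 1 s t) \<noteq> 0 \<longleftrightarrow> (\<exists>s'. length s' = length s \<and> best n s')" for n s t
    by (subst c0) (simp add: E best_def numeral_2_eq_2, metis)
  \<comment> \<open>The three opening moves are unfolded backwards; every level \<open>l\<close> can
    be chosen, since some list has length \<open>l\<close>.\<close>
  then have root: "c (position n 0 [] []) = 0 \<longleftrightarrow> (\<forall>l. \<exists>s. length s = l \<and> best n s)" for n
    by (subst c0) (simp add: E, metis length_replicate)
  have parallel_level: "s \<parallel> t" if "length s = length t" "s \<noteq> t" for s t :: "nat list"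
    using that by (metis parallel_def prefix_length_prefix prefix_order.eq_iff order_refl)
  have asym: "\<not> beats n t s" if "beats n s t" "length s = length t" "s \<noteq> t" for n s t
    using not_both_win[OF c, of n 3 s t] that parallel_level by (simp add: beats_def)
  have path_best: "best n (map x [0..<l])" if "x \<in> infinite_paths (T n)" for n x l
    using that infinite_path_wins(1)[OF c that, of 3 l] parallel_level
    by (auto simp: best_def beats_def infinite_paths_def)
  \<comment> \<open>Otherwise the parent \<open>u\<close> of \<open>t\<close> differs from
    \<open>s\<close>, so \<open>s\<close> beats \<open>u\<close> by some move to \<open>s'\<close>.
    The reply from \<open>u\<close> to \<open>t\<close> must still lose, so \<open>s'\<close> beats
    \<open>t\<close>; but \<open>t\<close> is best on its level and beats \<open>s'\<close>,
    contradicting \<open>asym\<close>.\<close>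
  have child_best: "child s t" if s: "best n s" and t: "best n t" and len: "length t = Suc (length s)" for n s t
  proof (rule ccontr)
    assume not_child: "\<not> child s t"
    define u where "u = butlast t"
    have t_snoc: "child u t" using len by (cases t rule: rev_cases) (auto simp: u_def child_def)
    then have u: "u \<in> T n" "length u = length s" "u \<noteq> s"
      using t len not_child tree[of n] by (auto simp: best_def is_tree_def child_def)
    then have "beats n s u" using s by (simp add: best_def)
    then obtain s' where s': "child s s'" "s' \<in> T n" "c (position n (Suc 3) u s') = 0"
      using c0[of n 3 s u] by (auto simp: E beats_def)
    have "u \<parallel> s'"
      using u s'(1) parallel_level sym mono unfolding child_def by metis
    then have "c (position n (Suc (Suc 3)) s' t) \<noteq> 0"
      using s' c0[of n "Suc 3" u s'] t t_snoc by (auto simp: E best_def)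
    moreover have "s' \<noteq> t" "length s' = length t"
      using s'(1) not_child len by (auto simp: child_def)
    \<comment> \<open>Two moves have been made since count 3, at which \<open>beats\<close> is
      defined.\<close>
    moreover have "c (position n (Suc (Suc 3)) s' t) = 0 \<longleftrightarrow> c (position n 3 s' t) = 0"
      using count_irrelevant[OF c refl, of "Suc 3"] count_irrelevant[OF c refl, of 3] by simp
    ultimately have "beats n s' t" "beats n t s'"
      using t s'(2) by (auto simp: best_def beats_def)
    then show False
      using asym[of n t s'] \<open>s' \<noteq> t\<close> \<open>length s' = length t\<close> by simp
  qed
  have "infinite_paths (T n) \<noteq> {} \<longleftrightarrow> c (position n 0 [] []) = 0" for n
  proof
    assume "infinite_paths (T n) \<noteq> {}"
    then obtain x where "x \<in> infinite_paths (T n)" by blast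
    then show "c (position n 0 [] []) = 0"
      unfolding root using path_best[of x n] by (metis diff_zero length_map length_upt)
  next
    assume "c (position n 0 [] []) = 0"
    then obtain \<sigma> where \<sigma>: "length (\<sigma> l) = l" "best n (\<sigma> l)" for l
      unfolding root by metis
    obtain x where "x \<in> infinite_paths (T n)"
    proof (rule infinite_path_of_chain[OF tree])
      show "child (\<sigma> i) (\<sigma> (Suc i))" for i
        using child_best[OF \<sigma>(2) \<sigma>(2)] by (simp add: \<sigma>(1))
      show "\<sigma> (Suc i) \<in> T n" for i
        using \<sigma>(2) by (simp add: best_def)
    qed
    then show "infinite_paths (T n) \<noteq> {}" by blast
  qed
  moreover have "card (infinite_paths (T n)) = 1 \<longleftrightarrow> infinite_paths (T n) \<noteq> {}" for n
  proof -
    have "finite (infinite_paths (T n))" "card (infinite_paths (T n)) \<le> 1"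
      using T(1) by (auto simp: Sigma11_CA_minus_def)
    then show ?thesis using card_gt_0_iff[of "infinite_paths (T n)"] by auto
  qed
  ultimately have "card (infinite_paths (T n)) = 1 \<longleftrightarrow> c (position n 0 [] []) = 0" for n
    by simp
  then show "(\<lambda>n. of_bool (c (position n 0 [] []) = 0)) \<in> solutions Sigma11_CA_minus T"
    by (auto simp: Sigma11_CA_minus_def)
qed

theorem theorem3p11:
  shows "UC \<equiv>\<^sub>s\<^sub>W Sigma11_UC \<and> UC \<equiv>\<^sub>s\<^sub>W Sigma11_Sep \<and> UC \<equiv>\<^sub>s\<^sub>W Delta11_CA \<and> UC \<equiv>\<^sub>s\<^sub>W Delta11_CA_minus \<and> UC \<equiv>\<^sub>s\<^sub>W Sigma11_CA_minus \<and>
    Sigma11_UC \<equiv>\<^sub>s\<^sub>W Sigma11_Sep \<and> Sigma11_UC \<equiv>\<^sub>s\<^sub>W Delta11_CA \<and> Sigma11_UC \<equiv>\<^sub>s\<^sub>W Delta11_CA_minus \<and> Sigma11_UC \<equiv>\<^sub>s\<^sub>W Sigma11_CA_minus \<and>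
    Sigma11_Sep \<equiv>\<^sub>s\<^sub>W Delta11_CA \<and> Sigma11_Sep \<equiv>\<^sub>s\<^sub>W Delta11_CA_minus \<and> Sigma11_Sep \<equiv>\<^sub>s\<^sub>W Sigma11_CA_minus \<and>
    Delta11_CA \<equiv>\<^sub>s\<^sub>W Delta11_CA_minus \<and> Delta11_CA \<equiv>\<^sub>s\<^sub>W Sigma11_CA_minus \<and>
    Delta11_CA_minus \<equiv>\<^sub>s\<^sub>W Sigma11_CA_minus"
proof -
  have Delta: "Delta11_CA_minus \<le>\<^sub>s\<^sub>W Delta11_CA" "Delta11_CA \<le>\<^sub>s\<^sub>W Sigma11_Sep"
    unfolding Delta11_CA_minus_def Delta11_CA_def by (rule restrict_problem_sW_reducible)+
  note trans = sW_reducible_trans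
  \<comment> \<open>All problems are compared through \<open>UC\<close>: these are the reductions to
    it, and \<open>UC_le\<close> collects those from it.\<close>
  note le_UC = trans[OF Sigma11_UC_sW_reducible_Sigma11_Sep Sigma11_Sep_sW_reducible_UC]
    Sigma11_Sep_sW_reducible_UC Sigma11_CA_minus_sW_reducible_UC
    trans[OF Delta(2) Sigma11_Sep_sW_reducible_UC]
    trans[OF Delta(1) trans[OF Delta(2) Sigma11_Sep_sW_reducible_UC]]
  note UC_le = UC_sW_reducible_Sigma11_UC UC_sW_reducible_Sigma11_CA_minus
    UC_sW_reducible_Delta11_CA_minus trans[OF UC_sW_reducible_Delta11_CA_minus Delta(1)]
    trans[OF trans[OF UC_sW_reducible_Delta11_CA_minus Delta(1)] Delta(2)]
  show ?thesis
    unfolding sW_equivalent_def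
    by (intro conjI le_UC UC_le) (rule trans, rule le_UC, rule UC_le)+
qed

end
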